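(* Let $F\colon\mathcal S\to\mathcal T$ be a fully faithful exact functor between triangulated categories which admits a right adjoint $G\colon\mathcal T\to\mathcal S$. Suppose that $$X_{\mathcal S}\xrightarrow{\alpha_{\mathcal S}}Y_{\mathcal S}\xrightarrow{\beta_{\mathcal S}}Z_{\mathcal S}\xrightarrow{\gamma_{\mathcal S}}X_{\mathcal S}[1]\quad\text{and}\quad X_{\mathcal T}\xrightarrow{\alpha_{\mathcal T}}Y_{\mathcal T}\xrightarrow{\beta_{\mathcal T}}Z_{\mathcal T}\xrightarrow{\gamma_{\mathcal T}}X_{\mathcal T}[1]$$ are Auslander-Reiten triangles in $\mathcal S$ and $\mathcal T$ respectively, where $Z_{\mathcal T}=FZ_{\mathcal S}$. Then $$GX_{\mathcal T}\xrightarrow{G\alpha_{\mathcal T}}GY_{\mathcal T}\xrightarrow{G\beta_{\mathcal T}}GZ_{\mathcal T}\xrightarrow{G\gamma_{\mathcal T}}GX_{\mathcal T}[1]$$ is the coproduct of $X_{\mathcal S}\xrightarrow{\alpha_{\mathcal S}}Y_{\mathcal S}\xrightarrow{\beta_{\mathcal S}}Z_{\mathcal S}\xrightarrow{\gamma_{\mathcal S}}X_{\mathcal S}[1]$ and a triangle $W\xrightarrow{\mathrm{id}}W\to0\to W[1]$ for some object $W$ of $\mathcal S$.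
   Context: A map $\alpha\colon X\to Y$ is left almost split if $\alpha$ is not a section and every map $X\to Y'$ which is not a section factors through $\alpha$. A map $\beta\colon Y\to Z$ is right almost split if $\beta$ is not a retraction and every map $Y'\to Z$ which is not a retraction factors through $\beta$. An exact triangle $X\xrightarrow{\alpha}Y\xrightarrow{\beta}Z\xrightarrow{\gamma}X[1]$ in a triangulated category is an Auslander-Reiten triangle if $\alpha$ is left almost split and $\beta$ is right almost split. "Is the coproduct of" is meant up to isomorphism of triangles, with $GZ_{\mathcal T}=GFZ_{\mathcal S}$ identified with $Z_{\mathcal S}$ via the unit isomorphism $\mathrm{Id}_{\mathcal S}\cong G\circ F$. *)

theory Defs
  imports "HOL-Algebra.Group"
begin

section \<open>Categories, functors and adjunctions\<close>

text \<open>Morphisms carry their source and target, so hom-sets are automatically disjoint. Composition is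
  written in the usual order (\<open>g \<cdot> f\<close> is \<open>f\<close> followed by \<open>g\<close>) and is unspecified on non-composable
  pairs.\<close>

record ('o, 'm) cat =
  Obj :: "'o set"
  Arr :: "'m set"
  Dom :: "'m \<Rightarrow> 'o"
  Cod :: "'m \<Rightarrow> 'o"
  Ident :: "'o \<Rightarrow> 'm"
  Compose :: "'m \<Rightarrow> 'm \<Rightarrow> 'm" (infixl \<open>\<cdot>\<index>\<close> 70)

definition Mor :: "('o, 'm, 'b) cat_scheme \<Rightarrow> 'o \<Rightarrow> 'o \<Rightarrow> 'm set" where
  "Mor C A B = {f \<in> Arr C. Dom C f = A \<and> Cod C f = B}"

locale category =
  fixes C :: "('o, 'm, 'b) cat_scheme" (structure)
  assumes dom_obj: "f \<in> Arr C \<Longrightarrow> Dom C f \<in> Obj C"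
    and cod_obj: "f \<in> Arr C \<Longrightarrow> Cod C f \<in> Obj C"
    and ident_mor: "A \<in> Obj C \<Longrightarrow> Ident C A \<in> Mor C A A"
    and comp_mor: "f \<in> Mor C A B \<Longrightarrow> g \<in> Mor C B D \<Longrightarrow> g \<cdot> f \<in> Mor C A D"
    and comp_ident_right: "f \<in> Mor C A B \<Longrightarrow> f \<cdot> Ident C A = f"
    and comp_ident_left: "f \<in> Mor C A B \<Longrightarrow> Ident C B \<cdot> f = f"
    and comp_assoc: "f \<in> Mor C A B \<Longrightarrow> g \<in> Mor C B D \<Longrightarrow> h \<in> Mor C D E \<Longrightarrow>
      (h \<cdot> g) \<cdot> f = h \<cdot> (g \<cdot> f)"

definition is_section :: "('o, 'm, 'b) cat_scheme \<Rightarrow> 'o \<Rightarrow> 'o \<Rightarrow> 'm \<Rightarrow> bool" where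
  "is_section C A B f \<longleftrightarrow> f \<in> Mor C A B \<and> (\<exists>g \<in> Mor C B A. g \<cdot>\<^bsub>C\<^esub> f = Ident C A)"

definition is_retraction :: "('o, 'm, 'b) cat_scheme \<Rightarrow> 'o \<Rightarrow> 'o \<Rightarrow> 'm \<Rightarrow> bool" where
  "is_retraction C A B f \<longleftrightarrow> f \<in> Mor C A B \<and> (\<exists>g \<in> Mor C B A. f \<cdot>\<^bsub>C\<^esub> g = Ident C B)"

definition inverse_arrows :: "('o, 'm, 'b) cat_scheme \<Rightarrow> 'o \<Rightarrow> 'o \<Rightarrow> 'm \<Rightarrow> 'm \<Rightarrow> bool" where
  "inverse_arrows C A B f g \<longleftrightarrow> f \<in> Mor C A B \<and> g \<in> Mor C B A \<and>
     g \<cdot>\<^bsub>C\<^esub> f = Ident C A \<and> f \<cdot>\<^bsub>C\<^esub> g = Ident C B"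

definition is_isomorphism :: "('o, 'm, 'b) cat_scheme \<Rightarrow> 'o \<Rightarrow> 'o \<Rightarrow> 'm \<Rightarrow> bool" where
  "is_isomorphism C A B f \<longleftrightarrow> (\<exists>g. inverse_arrows C A B f g)"

definition inv_arrow :: "('o, 'm, 'b) cat_scheme \<Rightarrow> 'o \<Rightarrow> 'o \<Rightarrow> 'm \<Rightarrow> 'm" where
  "inv_arrow C A B f = (THE g. inverse_arrows C A B f g)"

definition is_zero_object :: "('o, 'm, 'b) cat_scheme \<Rightarrow> 'o \<Rightarrow> bool" where
  "is_zero_object C Z \<longleftrightarrow> Z \<in> Obj C \<and>
     (\<forall>A \<in> Obj C. (\<exists>!f. f \<in> Mor C A Z) \<and> (\<exists>!f. f \<in> Mor C Z A))"

definition is_coproduct :: "('o, 'm, 'b) cat_scheme \<Rightarrow> 'o \<Rightarrow> 'o \<Rightarrow> 'o \<Rightarrow> 'm \<Rightarrow> 'm \<Rightarrow> bool" where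
  "is_coproduct C A B P i j \<longleftrightarrow> i \<in> Mor C A P \<and> j \<in> Mor C B P \<and>
     (\<forall>Q \<in> Obj C. \<forall>f \<in> Mor C A Q. \<forall>g \<in> Mor C B Q.
        \<exists>!h. h \<in> Mor C P Q \<and> h \<cdot>\<^bsub>C\<^esub> i = f \<and> h \<cdot>\<^bsub>C\<^esub> j = g)"

record ('o1, 'm1, 'o2, 'm2) functr =
  omap :: "'o1 \<Rightarrow> 'o2"
  amap :: "'m1 \<Rightarrow> 'm2"

definition id_functor :: "('o, 'm, 'o, 'm) functr" where
  "id_functor = \<lparr>omap = (\<lambda>A. A), amap = (\<lambda>f. f)\<rparr>"

definition comp_functor ::
  "('o2, 'm2, 'o3, 'm3) functr \<Rightarrow> ('o1, 'm1, 'o2, 'm2) functr \<Rightarrow> ('o1, 'm1, 'o3, 'm3) functr"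
  (infixl \<open>\<circ>\<^sub>F\<close> 55) where
  "G \<circ>\<^sub>F F = \<lparr>omap = omap G \<circ> omap F, amap = amap G \<circ> amap F\<rparr>"

locale is_functor = D: category D + E: category E
  for D :: "('o1, 'm1, 'b) cat_scheme" and E :: "('o2, 'm2, 'c) cat_scheme"
    and F :: "('o1, 'm1, 'o2, 'm2) functr" +
  assumes omap_obj: "A \<in> Obj D \<Longrightarrow> omap F A \<in> Obj E"
    and amap_mor: "f \<in> Mor D A B \<Longrightarrow> amap F f \<in> Mor E (omap F A) (omap F B)"
    and amap_ident: "A \<in> Obj D \<Longrightarrow> amap F (Ident D A) = Ident E (omap F A)"
    and amap_comp: "f \<in> Mor D A B \<Longrightarrow> g \<in> Mor D B B' \<Longrightarrow>
      amap F (g \<cdot>\<^bsub>D\<^esub> f) = amap F g \<cdot>\<^bsub>E\<^esub> amap F f"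

definition fully_faithful ::
  "('o1, 'm1, 'b) cat_scheme \<Rightarrow> ('o2, 'm2, 'c) cat_scheme \<Rightarrow> ('o1, 'm1, 'o2, 'm2) functr \<Rightarrow> bool" where
  "fully_faithful D E F \<longleftrightarrow>
     (\<forall>A \<in> Obj D. \<forall>B \<in> Obj D. bij_betw (amap F) (Mor D A B) (Mor E (omap F A) (omap F B)))"

definition essentially_surjective ::
  "('o1, 'm1, 'b) cat_scheme \<Rightarrow> ('o2, 'm2, 'c) cat_scheme \<Rightarrow> ('o1, 'm1, 'o2, 'm2) functr \<Rightarrow> bool" where
  "essentially_surjective D E F \<longleftrightarrow> (\<forall>B \<in> Obj E. \<exists>A \<in> Obj D. \<exists>f. is_isomorphism E (omap F A) B f)"

definition nat_trans ::
  "('o1, 'm1, 'b) cat_scheme \<Rightarrow> ('o2, 'm2, 'c) cat_scheme \<Rightarrow> ('o1, 'm1, 'o2, 'm2) functr \<Rightarrow>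
   ('o1, 'm1, 'o2, 'm2) functr \<Rightarrow> ('o1 \<Rightarrow> 'm2) \<Rightarrow> bool" where
  "nat_trans D E F G \<tau> \<longleftrightarrow>
     (\<forall>A \<in> Obj D. \<tau> A \<in> Mor E (omap F A) (omap G A)) \<and>
     (\<forall>A B. \<forall>f \<in> Mor D A B. \<tau> B \<cdot>\<^bsub>E\<^esub> amap F f = amap G f \<cdot>\<^bsub>E\<^esub> \<tau> A)"

definition nat_iso ::
  "('o1, 'm1, 'b) cat_scheme \<Rightarrow> ('o2, 'm2, 'c) cat_scheme \<Rightarrow> ('o1, 'm1, 'o2, 'm2) functr \<Rightarrow>
   ('o1, 'm1, 'o2, 'm2) functr \<Rightarrow> ('o1 \<Rightarrow> 'm2) \<Rightarrow> bool" where
  "nat_iso D E F G \<tau> \<longleftrightarrow> nat_trans D E F G \<tau> \<and>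
     (\<forall>A \<in> Obj D. is_isomorphism E (omap F A) (omap G A) (\<tau> A))"

text \<open>\<open>F\<close> is left adjoint to \<open>G\<close>, with unit \<open>\<eta>\<close> and counit \<open>\<epsilon>\<close>.\<close>

locale adjunction = F: is_functor D E F + G: is_functor E D G
  for D :: "('o1, 'm1, 'b) cat_scheme" and E :: "('o2, 'm2, 'c) cat_scheme"
    and F :: "('o1, 'm1, 'o2, 'm2) functr" and G :: "('o2, 'm2, 'o1, 'm1) functr"
    and \<eta> :: "'o1 \<Rightarrow> 'm1" and \<epsilon> :: "'o2 \<Rightarrow> 'm2" +
  assumes unit: "nat_trans D D id_functor (G \<circ>\<^sub>F F) \<eta>"
    and counit: "nat_trans E E (F \<circ>\<^sub>F G) id_functor \<epsilon>"
    and triangle_left: "A \<in> Obj D \<Longrightarrow> \<epsilon> (omap F A) \<cdot>\<^bsub>E\<^esub> amap F (\<eta> A) = Ident E (omap F A)"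
    and triangle_right: "B \<in> Obj E \<Longrightarrow> amap G (\<epsilon> B) \<cdot>\<^bsub>D\<^esub> \<eta> (omap G B) = Ident D (omap G B)"


section \<open>Additive categories\<close>

record ('o, 'm) preadd_cat = "('o, 'm) cat" +
  Plus :: "'m \<Rightarrow> 'm \<Rightarrow> 'm" (infixl \<open>\<oplus>\<index>\<close> 65)
  Zero :: "'o \<Rightarrow> 'o \<Rightarrow> 'm"

definition hom_group :: "('o, 'm, 'b) preadd_cat_scheme \<Rightarrow> 'o \<Rightarrow> 'o \<Rightarrow> 'm monoid" where
  "hom_group C A B = \<lparr>carrier = Mor C A B, mult = Plus C, one = Zero C A B\<rparr>"

definition Neg :: "('o, 'm, 'b) preadd_cat_scheme \<Rightarrow> 'm \<Rightarrow> 'm" where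
  "Neg C f = inv\<^bsub>hom_group C (Dom C f) (Cod C f)\<^esub> f"

locale additive_category = category C
  for C :: "('o, 'm, 'b) preadd_cat_scheme" (structure) +
  assumes hom_comm_group: "A \<in> Obj C \<Longrightarrow> B \<in> Obj C \<Longrightarrow> comm_group (hom_group C A B)"
    and comp_plus_left: "f \<in> Mor C A B \<Longrightarrow> f' \<in> Mor C A B \<Longrightarrow> g \<in> Mor C B D \<Longrightarrow>
      g \<cdot> (f \<oplus> f') = (g \<cdot> f) \<oplus> (g \<cdot> f')"
    and comp_plus_right: "f \<in> Mor C A B \<Longrightarrow> g \<in> Mor C B D \<Longrightarrow> g' \<in> Mor C B D \<Longrightarrow>
      (g \<oplus> g') \<cdot> f = (g \<cdot> f) \<oplus> (g' \<cdot> f)"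
    and ex_zero_object: "\<exists>Z. is_zero_object C Z"
    and ex_coproduct: "A \<in> Obj C \<Longrightarrow> B \<in> Obj C \<Longrightarrow> \<exists>P \<in> Obj C. \<exists>i j. is_coproduct C A B P i j"

locale additive_functor = D: additive_category D + E: additive_category E + is_functor D E F
  for D :: "('o1, 'm1, 'b) preadd_cat_scheme" and E :: "('o2, 'm2, 'c) preadd_cat_scheme"
    and F :: "('o1, 'm1, 'o2, 'm2) functr" +
  assumes amap_plus: "f \<in> Mor D A B \<Longrightarrow> g \<in> Mor D A B \<Longrightarrow>
    amap F (f \<oplus>\<^bsub>D\<^esub> g) = amap F f \<oplus>\<^bsub>E\<^esub> amap F g"


section \<open>Triangulated categories\<close>

text \<open>\<open>Triangle X Y Z f g h\<close> stands for \<open>X \<rightarrow> Y \<rightarrow> Z \<rightarrow> X[1]\<close>.\<close>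

datatype ('o, 'm) triangle = Triangle 'o 'o 'o 'm 'm 'm

record ('o, 'm) triang_cat = "('o, 'm) preadd_cat" +
  Shift :: "('o, 'm, 'o, 'm) functr"
  Exact :: "('o, 'm) triangle set"

abbreviation shift_obj :: "('o, 'm, 'b) triang_cat_scheme \<Rightarrow> 'o \<Rightarrow> 'o" (\<open>\<Sigma>\<^sub>o\<index>\<close>) where
  "\<Sigma>\<^sub>o\<^bsub>C\<^esub> \<equiv> omap (Shift C)"

abbreviation shift_mor :: "('o, 'm, 'b) triang_cat_scheme \<Rightarrow> 'm \<Rightarrow> 'm" (\<open>\<Sigma>\<^sub>m\<index>\<close>) where
  "\<Sigma>\<^sub>m\<^bsub>C\<^esub> \<equiv> amap (Shift C)"

fun is_triangle :: "('o, 'm, 'b) triang_cat_scheme \<Rightarrow> ('o, 'm) triangle \<Rightarrow> bool" where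
  "is_triangle C (Triangle X Y Z f g h) \<longleftrightarrow>
     f \<in> Mor C X Y \<and> g \<in> Mor C Y Z \<and> h \<in> Mor C Z (\<Sigma>\<^sub>o\<^bsub>C\<^esub> X)"

fun triangle_mor ::
  "('o, 'm, 'b) triang_cat_scheme \<Rightarrow> ('o, 'm) triangle \<Rightarrow> ('o, 'm) triangle \<Rightarrow> 'm \<Rightarrow> 'm \<Rightarrow> 'm \<Rightarrow> bool" where
  "triangle_mor C (Triangle X Y Z f g h) (Triangle X' Y' Z' f' g' h') u v w \<longleftrightarrow>
     is_triangle C (Triangle X Y Z f g h) \<and> is_triangle C (Triangle X' Y' Z' f' g' h') \<and>
     u \<in> Mor C X X' \<and> v \<in> Mor C Y Y' \<and> w \<in> Mor C Z Z' \<and>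
     v \<cdot>\<^bsub>C\<^esub> f = f' \<cdot>\<^bsub>C\<^esub> u \<and> w \<cdot>\<^bsub>C\<^esub> g = g' \<cdot>\<^bsub>C\<^esub> v \<and>
     \<Sigma>\<^sub>m\<^bsub>C\<^esub> u \<cdot>\<^bsub>C\<^esub> h = h' \<cdot>\<^bsub>C\<^esub> w"

fun triangle_iso ::
  "('o, 'm, 'b) triang_cat_scheme \<Rightarrow> ('o, 'm) triangle \<Rightarrow> ('o, 'm) triangle \<Rightarrow> 'm \<Rightarrow> 'm \<Rightarrow> 'm \<Rightarrow> bool" where
  "triangle_iso C (Triangle X Y Z f g h) (Triangle X' Y' Z' f' g' h') u v w \<longleftrightarrow>
     triangle_mor C (Triangle X Y Z f g h) (Triangle X' Y' Z' f' g' h') u v w \<and>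
     is_isomorphism C X X' u \<and> is_isomorphism C Y Y' v \<and> is_isomorphism C Z Z' w"

text \<open>The shift is only required to be an auto-equivalence, not an automorphism. In the octahedral axiom
  \<open>U\<close>, \<open>V\<close>, \<open>W\<close> are cones of \<open>f\<close>, \<open>g \<cdot> f\<close>, \<open>g\<close> respectively.\<close>

locale triangulated_category = additive_category C + shift: additive_functor C C "Shift C"
  for C :: "('o, 'm, 'b) triang_cat_scheme" (structure) +
  assumes shift_fully_faithful: "fully_faithful C C (Shift C)"
    and shift_essentially_surjective: "essentially_surjective C C (Shift C)"
    and exact_is_triangle: "t \<in> Exact C \<Longrightarrow> is_triangle C t"
    and exact_iso_closed: "t \<in> Exact C \<Longrightarrow> triangle_iso C t t' u v w \<Longrightarrow> t' \<in> Exact C"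
    and exact_ident: "X \<in> Obj C \<Longrightarrow> is_zero_object C Z \<Longrightarrow>
      Triangle X X Z (Ident C X) (Zero C X Z) (Zero C Z (\<Sigma>\<^sub>o X)) \<in> Exact C"
    and exact_completion: "f \<in> Mor C X Y \<Longrightarrow> \<exists>Z g h. Triangle X Y Z f g h \<in> Exact C"
    and exact_rotation: "is_triangle C (Triangle X Y Z f g h) \<Longrightarrow>
      Triangle X Y Z f g h \<in> Exact C \<longleftrightarrow>
      Triangle Y Z (\<Sigma>\<^sub>o X) g h (Neg C (\<Sigma>\<^sub>m f)) \<in> Exact C"
    and exact_mor_completion:
      "Triangle X Y Z f g h \<in> Exact C \<Longrightarrow> Triangle X' Y' Z' f' g' h' \<in> Exact C \<Longrightarrow>
       u \<in> Mor C X X' \<Longrightarrow> v \<in> Mor C Y Y' \<Longrightarrow> v \<cdot> f = f' \<cdot> u \<Longrightarrow>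
       \<exists>w. triangle_mor C (Triangle X Y Z f g h) (Triangle X' Y' Z' f' g' h') u v w"
    and octahedral:
      "Triangle X Y U f f' f'' \<in> Exact C \<Longrightarrow> Triangle Y Z W g g' g'' \<in> Exact C \<Longrightarrow>
       Triangle X Z V (g \<cdot> f) h' h'' \<in> Exact C \<Longrightarrow>
       \<exists>u v. Triangle U V W u v (\<Sigma>\<^sub>m f' \<cdot> g'') \<in> Exact C \<and>
             u \<cdot> f' = h' \<cdot> g \<and> h'' \<cdot> u = f'' \<and> v \<cdot> h' = g' \<and> g'' \<cdot> v = \<Sigma>\<^sub>m f \<cdot> h''"

text \<open>An exact functor is an additive functor \<open>F\<close> together with a natural isomorphism
  \<open>\<phi>\<^sub>X : F (X[1]) \<rightarrow> (F X)[1]\<close>, carrying exact triangles to exact triangles.\<close>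

locale exact_functor = D: triangulated_category D + E: triangulated_category E +
  additive_functor D E F
  for D :: "('o1, 'm1, 'b) triang_cat_scheme" and E :: "('o2, 'm2, 'c) triang_cat_scheme"
    and F :: "('o1, 'm1, 'o2, 'm2) functr" and \<phi> :: "'o1 \<Rightarrow> 'm2" +
  assumes shift_iso: "nat_iso D E (F \<circ>\<^sub>F Shift D) (Shift E \<circ>\<^sub>F F) \<phi>"
    and preserves_exact: "Triangle X Y Z f g h \<in> Exact D \<Longrightarrow>
      Triangle (omap F X) (omap F Y) (omap F Z) (amap F f) (amap F g) (\<phi> X \<cdot>\<^bsub>E\<^esub> amap F h) \<in> Exact E"


section \<open>Almost split morphisms and Auslander-Reiten triangles\<close>

definition left_almost_split :: "('o, 'm, 'b) cat_scheme \<Rightarrow> 'o \<Rightarrow> 'o \<Rightarrow> 'm \<Rightarrow> bool" where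
  "left_almost_split C X Y \<alpha> \<longleftrightarrow> \<alpha> \<in> Mor C X Y \<and> \<not> is_section C X Y \<alpha> \<and>
     (\<forall>Y' \<in> Obj C. \<forall>f \<in> Mor C X Y'. \<not> is_section C X Y' f \<longrightarrow> (\<exists>g \<in> Mor C Y Y'. f = g \<cdot>\<^bsub>C\<^esub> \<alpha>))"

definition right_almost_split :: "('o, 'm, 'b) cat_scheme \<Rightarrow> 'o \<Rightarrow> 'o \<Rightarrow> 'm \<Rightarrow> bool" where
  "right_almost_split C Y Z \<beta> \<longleftrightarrow> \<beta> \<in> Mor C Y Z \<and> \<not> is_retraction C Y Z \<beta> \<and>
     (\<forall>Y' \<in> Obj C. \<forall>f \<in> Mor C Y' Z. \<not> is_retraction C Y' Z f \<longrightarrow> (\<exists>g \<in> Mor C Y' Y. f = \<beta> \<cdot>\<^bsub>C\<^esub> g))"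

fun AR_triangle :: "('o, 'm, 'b) triang_cat_scheme \<Rightarrow> ('o, 'm) triangle \<Rightarrow> bool" where
  "AR_triangle C (Triangle X Y Z \<alpha> \<beta> \<gamma>) \<longleftrightarrow>
     Triangle X Y Z \<alpha> \<beta> \<gamma> \<in> Exact C \<and> left_almost_split C X Y \<alpha> \<and> right_almost_split C Y Z \<beta>"


section \<open>Coproducts of triangles and the image of a triangle under a right adjoint\<close>

text \<open>The third triangle is a coproduct of the first two, with coprojections \<open>(i\<^sub>1, i\<^sub>2, i\<^sub>3)\<close> and
  \<open>(j\<^sub>1, j\<^sub>2, j\<^sub>3)\<close>: coproducts of triangles are formed in each degree separately. As with any
  universal property, this says that the third triangle is isomorphic to a chosen coproduct.\<close>

fun is_triangle_coproduct ::
  "('o, 'm, 'b) triang_cat_scheme \<Rightarrow> ('o, 'm) triangle \<Rightarrow> ('o, 'm) triangle \<Rightarrow> ('o, 'm) triangle \<Rightarrow>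
   'm \<times> 'm \<times> 'm \<Rightarrow> 'm \<times> 'm \<times> 'm \<Rightarrow> bool" where
  "is_triangle_coproduct C (Triangle A\<^sub>1 A\<^sub>2 A\<^sub>3 a\<^sub>1 a\<^sub>2 a\<^sub>3) (Triangle B\<^sub>1 B\<^sub>2 B\<^sub>3 b\<^sub>1 b\<^sub>2 b\<^sub>3)
       (Triangle P\<^sub>1 P\<^sub>2 P\<^sub>3 p\<^sub>1 p\<^sub>2 p\<^sub>3) (i\<^sub>1, i\<^sub>2, i\<^sub>3) (j\<^sub>1, j\<^sub>2, j\<^sub>3) \<longleftrightarrow>
     triangle_mor C (Triangle A\<^sub>1 A\<^sub>2 A\<^sub>3 a\<^sub>1 a\<^sub>2 a\<^sub>3) (Triangle P\<^sub>1 P\<^sub>2 P\<^sub>3 p\<^sub>1 p\<^sub>2 p\<^sub>3) i\<^sub>1 i\<^sub>2 i\<^sub>3 \<and>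
     triangle_mor C (Triangle B\<^sub>1 B\<^sub>2 B\<^sub>3 b\<^sub>1 b\<^sub>2 b\<^sub>3) (Triangle P\<^sub>1 P\<^sub>2 P\<^sub>3 p\<^sub>1 p\<^sub>2 p\<^sub>3) j\<^sub>1 j\<^sub>2 j\<^sub>3 \<and>
     is_coproduct C A\<^sub>1 B\<^sub>1 P\<^sub>1 i\<^sub>1 j\<^sub>1 \<and> is_coproduct C A\<^sub>2 B\<^sub>2 P\<^sub>2 i\<^sub>2 j\<^sub>2 \<and>
     is_coproduct C A\<^sub>3 B\<^sub>3 P\<^sub>3 i\<^sub>3 j\<^sub>3"

text \<open>The canonical comparison \<open>(G X)[1] \<rightarrow> G (X[1])\<close> for a right adjoint \<open>G\<close> of an exact functor
  \<open>(F, \<phi>)\<close>: it is the adjoint transpose of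
  \<open>F ((G X)[1]) \<rightarrow> (F (G X))[1] \<rightarrow> X[1]\<close>, the composite of \<open>\<phi>\<^bsub>G X\<^esub>\<close> and \<open>\<epsilon>\<^sub>X[1]\<close>. It is invertible
  (lemma \<open>radj_comparison_iso\<close>), and its inverse makes \<open>G\<close> an exact functor.\<close>

definition radj_comparison ::
  "('o1, 'm1, 'b) triang_cat_scheme \<Rightarrow> ('o2, 'm2, 'c) triang_cat_scheme \<Rightarrow>
   ('o1 \<Rightarrow> 'm2) \<Rightarrow> ('o2, 'm2, 'o1, 'm1) functr \<Rightarrow> ('o1 \<Rightarrow> 'm1) \<Rightarrow> ('o2 \<Rightarrow> 'm2) \<Rightarrow> 'o2 \<Rightarrow> 'm1" where
  "radj_comparison D E \<phi> G \<eta> \<epsilon> X =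
     amap G (\<Sigma>\<^sub>m\<^bsub>E\<^esub> (\<epsilon> X) \<cdot>\<^bsub>E\<^esub> \<phi> (omap G X)) \<cdot>\<^bsub>D\<^esub> \<eta> (\<Sigma>\<^sub>o\<^bsub>D\<^esub> (omap G X))"

definition radj_shift_iso ::
  "('o1, 'm1, 'b) triang_cat_scheme \<Rightarrow> ('o2, 'm2, 'c) triang_cat_scheme \<Rightarrow>
   ('o1 \<Rightarrow> 'm2) \<Rightarrow> ('o2, 'm2, 'o1, 'm1) functr \<Rightarrow> ('o1 \<Rightarrow> 'm1) \<Rightarrow> ('o2 \<Rightarrow> 'm2) \<Rightarrow> 'o2 \<Rightarrow> 'm1" where
  "radj_shift_iso D E \<phi> G \<eta> \<epsilon> X =
     inv_arrow D (\<Sigma>\<^sub>o\<^bsub>D\<^esub> (omap G X)) (omap G (\<Sigma>\<^sub>o\<^bsub>E\<^esub> X)) (radj_comparison D E \<phi> G \<eta> \<epsilon> X)"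

lemma (in category) inverse_arrows_unique:
  assumes "inverse_arrows C A B f g" "inverse_arrows C A B f g'" shows "g = g'"
proof -
  have m: "f \<in> Mor C A B" "g \<in> Mor C B A" "g' \<in> Mor C B A"
    and e: "g \<cdot> f = Ident C A" "f \<cdot> g' = Ident C B"
    using assms by (auto simp: inverse_arrows_def)
  have "g = g \<cdot> (f \<cdot> g')" using m e comp_ident_right by simp
  also have "\<dots> = (g \<cdot> f) \<cdot> g'" using comp_assoc[OF m(3,1,2)] by simp
  finally show ?thesis using m e comp_ident_left by simp
qed

lemma (in category) inv_arrow_works:
  assumes "is_isomorphism C A B f" shows "inverse_arrows C A B f (inv_arrow C A B f)"
proof -
  obtain g where g: "inverse_arrows C A B f g" using assms by (auto simp: is_isomorphism_def)
  show ?thesis unfolding inv_arrow_def by (rule theI[where P = "inverse_arrows C A B f", OF g]) (rule inverse_arrows_unique[OF _ g])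
qed

lemma radj_comparison_iso:
  assumes ex: "exact_functor D E F \<phi>" and ad: "adjunction D E F G \<eta> \<epsilon>" and X: "X \<in> Obj E"
  shows "is_isomorphism D (\<Sigma>\<^sub>o\<^bsub>D\<^esub> (omap G X)) (omap G (\<Sigma>\<^sub>o\<^bsub>E\<^esub> X)) (radj_comparison D E \<phi> G \<eta> \<epsilon> X)"
proof -
  interpret exact_functor D E F \<phi> by (rule ex)
  interpret adj: adjunction D E F G \<eta> \<epsilon> by (rule ad)
  let ?S = "\<lambda>A. \<Sigma>\<^sub>o\<^bsub>D\<^esub> A" and ?T = "\<lambda>A. \<Sigma>\<^sub>o\<^bsub>E\<^esub> A" and ?F = "omap F" and ?G = "omap G"
  let ?s = "\<lambda>A. \<Sigma>\<^sub>m\<^bsub>D\<^esub> A" and ?t = "\<lambda>A. \<Sigma>\<^sub>m\<^bsub>E\<^esub> A" and ?f = "amap F" and ?g = "amap G"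
  let ?psi = "radj_comparison D E \<phi> G \<eta> \<epsilon> X"
  have eta: "\<eta> A \<in> Mor D A (?G (?F A))" if "A \<in> Obj D" for A
    using adj.unit that by (simp add: nat_trans_def id_functor_def comp_functor_def)
  have eta_nat: "\<eta> B \<cdot>\<^bsub>D\<^esub> f = ?g (?f f) \<cdot>\<^bsub>D\<^esub> \<eta> A" if "f \<in> Mor D A B" for f A B
    using adj.unit that by (simp add: nat_trans_def id_functor_def comp_functor_def)
  have eps: "\<epsilon> B \<in> Mor E (?F (?G B)) B" if "B \<in> Obj E" for B
    using adj.counit that by (simp add: nat_trans_def id_functor_def comp_functor_def)
  have eps_nat: "\<epsilon> B \<cdot>\<^bsub>E\<^esub> ?f (?g f) = f \<cdot>\<^bsub>E\<^esub> \<epsilon> A" if "f \<in> Mor E A B" for f A B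
    using adj.counit that by (simp add: nat_trans_def id_functor_def comp_functor_def)
  have phi: "\<phi> A \<in> Mor E (?F (?S A)) (?T (?F A))" if "A \<in> Obj D" for A
    using shift_iso that by (simp add: nat_iso_def nat_trans_def comp_functor_def)
  have phi_nat: "\<phi> B \<cdot>\<^bsub>E\<^esub> ?f (?s f) = ?t (?f f) \<cdot>\<^bsub>E\<^esub> \<phi> A" if "f \<in> Mor D A B" for f A B
    using shift_iso that by (simp add: nat_iso_def nat_trans_def comp_functor_def)
  have phi_iso: "\<exists>q. inverse_arrows E (?F (?S A)) (?T (?F A)) (\<phi> A) q" if "A \<in> Obj D" for A
    using shift_iso that by (simp add: nat_iso_def comp_functor_def is_isomorphism_def)
  have psi: "?psi \<in> Mor D (?S (?G X)) (?G (?T X))"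
    unfolding radj_comparison_def
    by (rule D.comp_mor[OF eta[OF D.shift.omap_obj[OF adj.G.omap_obj[OF X]]]
          adj.G.amap_mor[OF E.comp_mor[OF phi[OF adj.G.omap_obj[OF X]] E.shift.amap_mor[OF eps[OF X]]]]])
  have trans_F: "\<epsilon> B \<cdot>\<^bsub>E\<^esub> ?f (?g b \<cdot>\<^bsub>D\<^esub> \<eta> A) = b" if A: "A \<in> Obj D" and B: "B \<in> Obj E"
    and b: "b \<in> Mor E (?F A) B" for A B b
  proof -
    have 1: "?g b \<in> Mor D (?G (?F A)) (?G B)" using b by (rule adj.G.amap_mor)
    have "\<epsilon> B \<cdot>\<^bsub>E\<^esub> ?f (?g b \<cdot>\<^bsub>D\<^esub> \<eta> A) = \<epsilon> B \<cdot>\<^bsub>E\<^esub> (?f (?g b) \<cdot>\<^bsub>E\<^esub> ?f (\<eta> A))"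
      using amap_comp[OF eta[OF A] 1] by simp
    also have "\<dots> = (\<epsilon> B \<cdot>\<^bsub>E\<^esub> ?f (?g b)) \<cdot>\<^bsub>E\<^esub> ?f (\<eta> A)"
      using E.comp_assoc[OF amap_mor[OF eta[OF A]] amap_mor[OF 1] eps[OF B]] by simp
    also have "\<dots> = (b \<cdot>\<^bsub>E\<^esub> \<epsilon> (?F A)) \<cdot>\<^bsub>E\<^esub> ?f (\<eta> A)" using eps_nat[OF b] by simp
    also have "\<dots> = b \<cdot>\<^bsub>E\<^esub> (\<epsilon> (?F A) \<cdot>\<^bsub>E\<^esub> ?f (\<eta> A))"
      using E.comp_assoc[OF amap_mor[OF eta[OF A]] eps[OF omap_obj[OF A]] b] by simp
    finally show ?thesis using adj.triangle_left[OF A] E.comp_ident_right[OF b] by simp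
  qed
  have trans_G: "?g (\<epsilon> B \<cdot>\<^bsub>E\<^esub> ?f k) \<cdot>\<^bsub>D\<^esub> \<eta> A = k" if A: "A \<in> Obj D" and B: "B \<in> Obj E"
    and k: "k \<in> Mor D A (?G B)" for A B k
  proof -
    have "?g (\<epsilon> B \<cdot>\<^bsub>E\<^esub> ?f k) \<cdot>\<^bsub>D\<^esub> \<eta> A = (?g (\<epsilon> B) \<cdot>\<^bsub>D\<^esub> ?g (?f k)) \<cdot>\<^bsub>D\<^esub> \<eta> A"
      using adj.G.amap_comp[OF amap_mor[OF k] eps[OF B]] by simp
    also have "\<dots> = ?g (\<epsilon> B) \<cdot>\<^bsub>D\<^esub> (?g (?f k) \<cdot>\<^bsub>D\<^esub> \<eta> A)"
      using D.comp_assoc[OF eta[OF A] adj.G.amap_mor[OF amap_mor[OF k]] adj.G.amap_mor[OF eps[OF B]]] by simp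
    also have "\<dots> = ?g (\<epsilon> B) \<cdot>\<^bsub>D\<^esub> (\<eta> (?G B) \<cdot>\<^bsub>D\<^esub> k)" using eta_nat[OF k] by simp
    also have "\<dots> = (?g (\<epsilon> B) \<cdot>\<^bsub>D\<^esub> \<eta> (?G B)) \<cdot>\<^bsub>D\<^esub> k"
      using D.comp_assoc[OF k eta[OF adj.G.omap_obj[OF B]] adj.G.amap_mor[OF eps[OF B]]] by simp
    finally show ?thesis using adj.triangle_right[OF B] D.comp_ident_left[OF k] by simp
  qed
  have psi_shift: "?psi \<cdot>\<^bsub>D\<^esub> ?s a = ?g (?t (\<epsilon> X \<cdot>\<^bsub>E\<^esub> ?f a) \<cdot>\<^bsub>E\<^esub> \<phi> A) \<cdot>\<^bsub>D\<^esub> \<eta> (?S A)"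
    if A: "A \<in> Obj D" and a: "a \<in> Mor D A (?G X)" for A a
  proof -
    note GX = adj.G.omap_obj[OF X]
    note sa = D.shift.amap_mor[OF a]
    have te: "?t (\<epsilon> X) \<in> Mor E (?T (?F (?G X))) (?T X)" using eps[OF X] by (rule E.shift.amap_mor)
    have c: "?t (\<epsilon> X) \<cdot>\<^bsub>E\<^esub> \<phi> (?G X) \<in> Mor E (?F (?S (?G X))) (?T X)" by (rule E.comp_mor[OF phi[OF GX] te])
    have "?psi \<cdot>\<^bsub>D\<^esub> ?s a = ?g (?t (\<epsilon> X) \<cdot>\<^bsub>E\<^esub> \<phi> (?G X)) \<cdot>\<^bsub>D\<^esub> (\<eta> (?S (?G X)) \<cdot>\<^bsub>D\<^esub> ?s a)"
      unfolding radj_comparison_def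
      using D.comp_assoc[OF sa eta[OF D.shift.omap_obj[OF GX]] adj.G.amap_mor[OF c]] by simp
    also have "\<dots> = ?g (?t (\<epsilon> X) \<cdot>\<^bsub>E\<^esub> \<phi> (?G X)) \<cdot>\<^bsub>D\<^esub> (?g (?f (?s a)) \<cdot>\<^bsub>D\<^esub> \<eta> (?S A))"
      using eta_nat[OF sa] by simp
    also have "\<dots> = (?g (?t (\<epsilon> X) \<cdot>\<^bsub>E\<^esub> \<phi> (?G X)) \<cdot>\<^bsub>D\<^esub> ?g (?f (?s a))) \<cdot>\<^bsub>D\<^esub> \<eta> (?S A)"
      using D.comp_assoc[OF eta[OF D.shift.omap_obj[OF A]] adj.G.amap_mor[OF amap_mor[OF sa]] adj.G.amap_mor[OF c]] by simp
    also have "\<dots> = ?g ((?t (\<epsilon> X) \<cdot>\<^bsub>E\<^esub> \<phi> (?G X)) \<cdot>\<^bsub>E\<^esub> ?f (?s a)) \<cdot>\<^bsub>D\<^esub> \<eta> (?S A)"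
      using adj.G.amap_comp[OF amap_mor[OF sa] c] by simp
    also have "(?t (\<epsilon> X) \<cdot>\<^bsub>E\<^esub> \<phi> (?G X)) \<cdot>\<^bsub>E\<^esub> ?f (?s a) = ?t (\<epsilon> X) \<cdot>\<^bsub>E\<^esub> (\<phi> (?G X) \<cdot>\<^bsub>E\<^esub> ?f (?s a))"
      using E.comp_assoc[OF amap_mor[OF sa] phi[OF GX] te] by simp
    also have "\<dots> = ?t (\<epsilon> X) \<cdot>\<^bsub>E\<^esub> (?t (?f a) \<cdot>\<^bsub>E\<^esub> \<phi> A)" using phi_nat[OF a] by simp
    also have "\<dots> = (?t (\<epsilon> X) \<cdot>\<^bsub>E\<^esub> ?t (?f a)) \<cdot>\<^bsub>E\<^esub> \<phi> A"
      using E.comp_assoc[OF phi[OF A] E.shift.amap_mor[OF amap_mor[OF a]] te] by simp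
    also have "\<dots> = ?t (\<epsilon> X \<cdot>\<^bsub>E\<^esub> ?f a) \<cdot>\<^bsub>E\<^esub> \<phi> A"
      using E.shift.amap_comp[OF amap_mor[OF a] eps[OF X]] by simp
    finally show ?thesis .
  qed
  have surj: "\<exists>h \<in> Mor D (?S A) (?S (?G X)). ?psi \<cdot>\<^bsub>D\<^esub> h = k"
    if A: "A \<in> Obj D" and k: "k \<in> Mor D (?S A) (?G (?T X))" for A k
  proof -
    obtain q where "inverse_arrows E (?F (?S A)) (?T (?F A)) (\<phi> A) q" using phi_iso[OF A] by blast
    then have q: "q \<in> Mor E (?T (?F A)) (?F (?S A))" "q \<cdot>\<^bsub>E\<^esub> \<phi> A = Ident E (?F (?S A))"
      by (auto simp: inverse_arrows_def)
    let ?k = "\<epsilon> (?T X) \<cdot>\<^bsub>E\<^esub> ?f k"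
    have k': "?k \<in> Mor E (?F (?S A)) (?T X)"
      by (rule E.comp_mor[OF amap_mor[OF k] eps[OF E.shift.omap_obj[OF X]]])
    have "?k \<cdot>\<^bsub>E\<^esub> q \<in> Mor E (?T (?F A)) (?T X)" by (rule E.comp_mor[OF q(1) k'])
    moreover have "?t ` Mor E (?F A) X = Mor E (?T (?F A)) (?T X)"
      by (rule bij_betw_imp_surj_on[OF E.shift_fully_faithful[unfolded fully_faithful_def, rule_format,
            OF omap_obj[OF A] X]])
    ultimately have "?k \<cdot>\<^bsub>E\<^esub> q \<in> ?t ` Mor E (?F A) X" by simp
    then obtain b where b: "?t b = ?k \<cdot>\<^bsub>E\<^esub> q" "b \<in> Mor E (?F A) X" by (rule imageE) (blast intro: that sym)
    let ?a = "?g b \<cdot>\<^bsub>D\<^esub> \<eta> A"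
    have a: "?a \<in> Mor D A (?G X)" by (rule D.comp_mor[OF eta[OF A] adj.G.amap_mor[OF b(2)]])
    have "?psi \<cdot>\<^bsub>D\<^esub> ?s ?a = ?g (?t b \<cdot>\<^bsub>E\<^esub> \<phi> A) \<cdot>\<^bsub>D\<^esub> \<eta> (?S A)"
      using psi_shift[OF A a] trans_F[OF A X b(2)] by simp
    also have "?t b \<cdot>\<^bsub>E\<^esub> \<phi> A = ?k"
      using b(1) E.comp_assoc[OF phi[OF A] q(1) k'] q(2) E.comp_ident_right[OF k'] by simp
    finally have "?psi \<cdot>\<^bsub>D\<^esub> ?s ?a = k" using trans_G[OF D.shift.omap_obj[OF A] E.shift.omap_obj[OF X] k] by simp
    then show ?thesis using D.shift.amap_mor[OF a] by blast
  qed
  have inj: "h = h'" if A: "A \<in> Obj D" and h: "h \<in> Mor D (?S A) (?S (?G X))"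
    and h': "h' \<in> Mor D (?S A) (?S (?G X))" and eq: "?psi \<cdot>\<^bsub>D\<^esub> h = ?psi \<cdot>\<^bsub>D\<^esub> h'" for A h h'
  proof -
    have "?s ` Mor D A (?G X) = Mor D (?S A) (?S (?G X))"
      by (rule bij_betw_imp_surj_on[OF D.shift_fully_faithful[unfolded fully_faithful_def, rule_format,
            OF A adj.G.omap_obj[OF X]]])
    then have im: "h \<in> ?s ` Mor D A (?G X)" "h' \<in> ?s ` Mor D A (?G X)" using h h' by simp_all
    obtain a where a: "a \<in> Mor D A (?G X)" "?s a = h" using im(1) by (rule imageE) (blast intro: that sym)
    obtain a' where a': "a' \<in> Mor D A (?G X)" "?s a' = h'" using im(2) by (rule imageE) (blast intro: that sym)
    obtain q where q: "inverse_arrows E (?F (?S A)) (?T (?F A)) (\<phi> A) q" using phi_iso[OF A] by blast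
    have qm: "q \<in> Mor E (?T (?F A)) (?F (?S A))" "\<phi> A \<cdot>\<^bsub>E\<^esub> q = Ident E (?T (?F A))"
      using q by (auto simp: inverse_arrows_def)
    have ea: "\<epsilon> X \<cdot>\<^bsub>E\<^esub> ?f c \<in> Mor E (?F A) X" if "c \<in> Mor D A (?G X)" for c
      by (rule E.comp_mor[OF amap_mor[OF that] eps[OF X]])
    have rec: "?t (\<epsilon> X \<cdot>\<^bsub>E\<^esub> ?f c) = (\<epsilon> (?T X) \<cdot>\<^bsub>E\<^esub> ?f (?psi \<cdot>\<^bsub>D\<^esub> ?s c)) \<cdot>\<^bsub>E\<^esub> q"
      if c: "c \<in> Mor D A (?G X)" for c
    proof -
      have tc: "?t (\<epsilon> X \<cdot>\<^bsub>E\<^esub> ?f c) \<in> Mor E (?T (?F A)) (?T X)" by (rule E.shift.amap_mor[OF ea[OF c]])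
      have "\<epsilon> (?T X) \<cdot>\<^bsub>E\<^esub> ?f (?psi \<cdot>\<^bsub>D\<^esub> ?s c) = ?t (\<epsilon> X \<cdot>\<^bsub>E\<^esub> ?f c) \<cdot>\<^bsub>E\<^esub> \<phi> A"
        using psi_shift[OF A c]
          trans_F[OF D.shift.omap_obj[OF A] E.shift.omap_obj[OF X] E.comp_mor[OF phi[OF A] tc]] by simp
      then show ?thesis using E.comp_assoc[OF qm(1) phi[OF A] tc] qm(2) E.comp_ident_right[OF tc] by simp
    qed
    have "?t (\<epsilon> X \<cdot>\<^bsub>E\<^esub> ?f a) = ?t (\<epsilon> X \<cdot>\<^bsub>E\<^esub> ?f a')" using rec[OF a(1)] rec[OF a'(1)] eq a(2) a'(2) by simp
    moreover have "inj_on ?t (Mor E (?F A) X)"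
      by (rule bij_betw_imp_inj_on[OF E.shift_fully_faithful[unfolded fully_faithful_def, rule_format,
            OF omap_obj[OF A] X]])
    ultimately have "\<epsilon> X \<cdot>\<^bsub>E\<^esub> ?f a = \<epsilon> X \<cdot>\<^bsub>E\<^esub> ?f a'" using ea[OF a(1)] ea[OF a'(1)] unfolding inj_on_def by blast
    then have "?g (\<epsilon> X \<cdot>\<^bsub>E\<^esub> ?f a) \<cdot>\<^bsub>D\<^esub> \<eta> A = ?g (\<epsilon> X \<cdot>\<^bsub>E\<^esub> ?f a') \<cdot>\<^bsub>D\<^esub> \<eta> A" by (rule arg_cong)
    then have "a = a'" unfolding trans_G[OF A X a(1)] trans_G[OF A X a'(1)] .
    then show ?thesis using a(2) a'(2) by simp
  qed
  note GX = adj.G.omap_obj[OF X] and GTX = adj.G.omap_obj[OF E.shift.omap_obj[OF X]]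
  obtain A e where A: "A \<in> Obj D" and "is_isomorphism D (?S A) (?G (?T X)) e"
    using D.shift_essentially_surjective GTX unfolding essentially_surjective_def by meson
  then obtain e' where e: "e \<in> Mor D (?S A) (?G (?T X))" "e' \<in> Mor D (?G (?T X)) (?S A)"
    "e \<cdot>\<^bsub>D\<^esub> e' = Ident D (?G (?T X))" by (auto simp: is_isomorphism_def inverse_arrows_def)
  obtain h where h: "h \<in> Mor D (?S A) (?S (?G X))" "?psi \<cdot>\<^bsub>D\<^esub> h = e" using surj[OF A e(1)] by blast
  let ?r = "h \<cdot>\<^bsub>D\<^esub> e'"
  have r: "?r \<in> Mor D (?G (?T X)) (?S (?G X))" by (rule D.comp_mor[OF e(2) h(1)])
  have right: "?psi \<cdot>\<^bsub>D\<^esub> ?r = Ident D (?G (?T X))" using D.comp_assoc[OF e(2) h(1) psi] h(2) e(3) by simp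
  have "?psi \<cdot>\<^bsub>D\<^esub> (?r \<cdot>\<^bsub>D\<^esub> ?psi) = ?psi"
    using D.comp_assoc[OF psi r psi] right D.comp_ident_left[OF psi] by simp
  then have "?r \<cdot>\<^bsub>D\<^esub> ?psi = Ident D (?S (?G X))"
    using inj[OF GX D.comp_mor[OF psi r] D.ident_mor[OF D.shift.omap_obj[OF GX]]] D.comp_ident_right[OF psi] by simp
  then show ?thesis using psi r right unfolding is_isomorphism_def inverse_arrows_def by blast
qed

text \<open>\<open>G X \<rightarrow> G Y \<rightarrow> G Z \<rightarrow> (G X)[1]\<close>, using \<open>\<psi>\<^sub>X : G (X[1]) \<rightarrow> (G X)[1]\<close>.\<close>

fun functor_triangle ::
  "('o1, 'm1, 'b) cat_scheme \<Rightarrow> ('o2, 'm2, 'o1, 'm1) functr \<Rightarrow> ('o2 \<Rightarrow> 'm1) \<Rightarrow>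
   ('o2, 'm2) triangle \<Rightarrow> ('o1, 'm1) triangle" where
  "functor_triangle D G \<psi> (Triangle X Y Z f g h) =
     Triangle (omap G X) (omap G Y) (omap G Z) (amap G f) (amap G g) (\<psi> X \<cdot>\<^bsub>D\<^esub> amap G h)"

end

theory Submission
  imports Defs
begin

text \<open>Since \<open>F\<close> is fully faithful, \<open>F \<beta>\<^sub>S\<close> is not a retraction (lemma
  \<open>retraction_if_image_retraction\<close>), so it factors through the right almost split map \<open>\<beta>\<^sub>T\<close>. This
  factorisation and the identity of \<open>F Z\<^sub>S = Z\<^sub>T\<close> extend to a morphism from the image under \<open>F\<close> of the
  triangle in \<open>S\<close> to the triangle in \<open>T\<close>. Transposing it along the adjunction gives a morphism
  \<open>(i\<^sub>X, i\<^sub>Y, \<eta>)\<close> from the triangle in \<open>S\<close> to the image under \<open>G\<close> of the triangle in \<open>T\<close> (lemma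
  \<open>right_transpose_triangle_mor\<close>), whose last component is invertible.

  The point is that \<open>i\<^sub>X\<close> is a section. Otherwise it would factor through the left almost split map
  \<open>\<alpha>\<^sub>S\<close>, and then \<open>i\<^sub>X[1] \<cdot> \<gamma>\<^sub>S\<close> would be zero (lemma \<open>AR_first_section\<close>). But this composite equals
  \<open>G \<gamma>\<^sub>T \<cdot> \<eta>\<close> up to an isomorphism, that is, the transpose of \<open>\<gamma>\<^sub>T\<close>, and \<open>\<gamma>\<^sub>T\<close> is nonzero because \<open>\<beta>\<^sub>T\<close>
  is not a retraction.

  A section in a triangulated category has a complement \<open>W\<close> (lemma \<open>section_complement\<close>), so
  \<open>G X\<^sub>T\<close> is the coproduct of \<open>X\<^sub>S\<close> and \<open>W\<close>. The third component being invertible, the same \<open>W\<close> is a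
  complement of \<open>Y\<^sub>S\<close> in \<open>G Y\<^sub>T\<close>: the rows \<open>X\<^sub>S \<oplus> W \<rightarrow> Y\<^sub>S \<oplus> W \<rightarrow> Z\<^sub>S\<close> and \<open>G X\<^sub>T \<rightarrow> G Y\<^sub>T \<rightarrow> G Z\<^sub>T\<close> are
  compared as in the five lemma, after applying \<open>Hom(Q, -)\<close> (lemma \<open>triangle_summand_if_section\<close>).
  What this chase uses of the second row is its exactness under \<open>Hom(Q, -)\<close>, which the
  adjunction carries over from \<open>T\<close> (lemma \<open>hom_exact_right_adjoint\<close>).\<close>

section \<open>Additive categories\<close>

text \<open>This says that \<open>(i, j)\<close> induces a bijection from \<open>Hom(Q, A) \<oplus> Hom(Q, B)\<close> to \<open>Hom(Q, P)\<close> for all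
  \<open>Q\<close>. Unlike the universal property of a coproduct, it can be verified with the exact sequences that
  a triangle yields on maps into it.\<close>

definition is_hom_sum ::
  "('o, 'm, 'b) preadd_cat_scheme \<Rightarrow> 'o \<Rightarrow> 'o \<Rightarrow> 'o \<Rightarrow> 'm \<Rightarrow> 'm \<Rightarrow> bool" where
  "is_hom_sum C A B P i j \<longleftrightarrow> i \<in> Mor C A P \<and> j \<in> Mor C B P \<and>
     (\<forall>Q. \<forall>y \<in> Mor C Q P.
        \<exists>a \<in> Mor C Q A. \<exists>b \<in> Mor C Q B. y = (i \<cdot>\<^bsub>C\<^esub> a) \<oplus>\<^bsub>C\<^esub> (j \<cdot>\<^bsub>C\<^esub> b)) \<and>
     (\<forall>Q. \<forall>a \<in> Mor C Q A. \<forall>b \<in> Mor C Q B.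
        (i \<cdot>\<^bsub>C\<^esub> a) \<oplus>\<^bsub>C\<^esub> (j \<cdot>\<^bsub>C\<^esub> b) = Zero C Q P \<longrightarrow> a = Zero C Q A \<and> b = Zero C Q B)"

lemma hom_sum_split:
  assumes "is_hom_sum C A B P i j" "y \<in> Mor C Q P"
  obtains a b where "a \<in> Mor C Q A" "b \<in> Mor C Q B" "y = (i \<cdot>\<^bsub>C\<^esub> a) \<oplus>\<^bsub>C\<^esub> (j \<cdot>\<^bsub>C\<^esub> b)"
  using assms unfolding is_hom_sum_def by blast

lemma hom_sum_unique:
  assumes "is_hom_sum C A B P i j" "a \<in> Mor C Q A" "b \<in> Mor C Q B"
    "(i \<cdot>\<^bsub>C\<^esub> a) \<oplus>\<^bsub>C\<^esub> (j \<cdot>\<^bsub>C\<^esub> b) = Zero C Q P"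
  shows "a = Zero C Q A \<and> b = Zero C Q B"
  using assms unfolding is_hom_sum_def by blast

context category
begin

lemma mor_dom: "f \<in> Mor C A B \<Longrightarrow> A \<in> Obj C"
  by (auto simp: Mor_def dom_obj)

lemma mor_cod: "f \<in> Mor C A B \<Longrightarrow> B \<in> Obj C"
  by (auto simp: Mor_def cod_obj)

end

context additive_category
begin

lemma zero_mor: "A \<in> Obj C \<Longrightarrow> B \<in> Obj C \<Longrightarrow> Zero C A B \<in> Mor C A B"
  using comm_group.axioms(2)[OF hom_comm_group, THEN group.is_monoid, THEN monoid.one_closed]
  by (simp add: hom_group_def)

lemma plus_mor: "f \<in> Mor C A B \<Longrightarrow> g \<in> Mor C A B \<Longrightarrow> f \<oplus> g \<in> Mor C A B"
  using comm_group.axioms(2)[OF hom_comm_group, THEN group.is_monoid, THEN monoid.m_closed,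
      of A B f g] mor_dom[of f A B] mor_cod[of f A B]
  by (simp add: hom_group_def)

lemma neg_mor: "f \<in> Mor C A B \<Longrightarrow> Neg C f \<in> Mor C A B"
  using comm_group.axioms(2)[OF hom_comm_group, THEN group.inv_closed, of A B f] mor_dom[of f A B] mor_cod[of f A B]
  by (simp add: hom_group_def Neg_def Mor_def)

lemma plus_assoc: "f \<in> Mor C A B \<Longrightarrow> g \<in> Mor C A B \<Longrightarrow> h \<in> Mor C A B \<Longrightarrow>
    (f \<oplus> g) \<oplus> h = f \<oplus> (g \<oplus> h)"
  using comm_group.axioms(2)[OF hom_comm_group, THEN group.is_monoid, THEN monoid.m_assoc,
      of A B f g h] mor_dom[of f A B] mor_cod[of f A B]
  by (simp add: hom_group_def)

lemma plus_comm: "f \<in> Mor C A B \<Longrightarrow> g \<in> Mor C A B \<Longrightarrow> f \<oplus> g = g \<oplus> f"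
  using comm_group.axioms(1)[OF hom_comm_group, THEN comm_monoid.m_comm, of A B f g]
    mor_dom[of f A B] mor_cod[of f A B]
  by (simp add: hom_group_def)

lemma zero_plus: "f \<in> Mor C A B \<Longrightarrow> Zero C A B \<oplus> f = f"
  using comm_group.axioms(2)[OF hom_comm_group, THEN group.is_monoid, THEN monoid.l_one,
      of A B f] mor_dom[of f A B] mor_cod[of f A B]
  by (simp add: hom_group_def)

lemma plus_zero: "f \<in> Mor C A B \<Longrightarrow> f \<oplus> Zero C A B = f"
  using zero_plus[of f A B] plus_comm[OF _ zero_mor] mor_dom[of f A B] mor_cod[of f A B] by simp

lemma plus_neg: "f \<in> Mor C A B \<Longrightarrow> f \<oplus> Neg C f = Zero C A B"
  using comm_group.axioms(2)[OF hom_comm_group, THEN group.r_inv, of A B f] mor_dom[of f A B] mor_cod[of f A B]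
  by (simp add: hom_group_def Neg_def Mor_def)

lemma neg_plus: "f \<in> Mor C A B \<Longrightarrow> Neg C f \<oplus> f = Zero C A B"
  using plus_neg[of f A B] plus_comm[OF _ neg_mor, of f A B f] by simp

lemma plus_left_cancel:
  assumes "f \<in> Mor C A B" "g \<in> Mor C A B" "h \<in> Mor C A B" "f \<oplus> g = f \<oplus> h"
  shows "g = h"
proof -
  note f = assms(1) and n = neg_mor[OF assms(1)]
  have "Neg C f \<oplus> (f \<oplus> k) = k" if "k \<in> Mor C A B" for k
    using plus_assoc[OF n f that] neg_plus[OF f] zero_plus[OF that] by simp
  from this[OF assms(2)] this[OF assms(3)] show ?thesis
    unfolding assms(4) by (rule trans[OF sym])
qed

lemma plus_interchange:
  assumes a: "a \<in> Mor C A B" and b: "b \<in> Mor C A B"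
    and c: "c \<in> Mor C A B" and d: "d \<in> Mor C A B"
  shows "(a \<oplus> b) \<oplus> (c \<oplus> d) = (a \<oplus> c) \<oplus> (b \<oplus> d)"
proof -
  have "(a \<oplus> b) \<oplus> (c \<oplus> d) = a \<oplus> ((b \<oplus> c) \<oplus> d)"
    using plus_assoc[OF a b plus_mor[OF c d]] plus_assoc[OF b c d] by simp
  also have "\<dots> = a \<oplus> (c \<oplus> (b \<oplus> d))"
    using plus_comm[OF b c] plus_assoc[OF c b d] by simp
  also have "\<dots> = (a \<oplus> c) \<oplus> (b \<oplus> d)"
    using plus_assoc[OF a c plus_mor[OF b d]] by simp
  finally show ?thesis .
qed

lemma eq_if_diff_zero:
  assumes "f \<in> Mor C A B" "g \<in> Mor C A B" "f \<oplus> Neg C g = Zero C A B" shows "f = g"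
proof (rule plus_left_cancel)
  show "Neg C g \<in> Mor C A B" by (rule neg_mor[OF assms(2)])
  show "Neg C g \<oplus> f = Neg C g \<oplus> g"
    using plus_comm[OF assms(1) neg_mor[OF assms(2)]] assms(3) neg_plus[OF assms(2)] by simp
qed (rule assms)+

lemma neg_inject:
  assumes "f \<in> Mor C A B" "g \<in> Mor C A B" "Neg C f = Neg C g" shows "f = g"
proof (rule eq_if_diff_zero)
  show "f \<oplus> Neg C g = Zero C A B" using plus_neg[OF assms(1)] assms(3) by simp
qed (rule assms)+

lemma comp_zero_right:
  assumes g: "g \<in> Mor C B D" and A: "A \<in> Obj C" shows "g \<cdot> Zero C A B = Zero C A D"
proof -
  have z: "Zero C A B \<in> Mor C A B" by (rule zero_mor[OF A mor_dom[OF g]])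
  note gz = comp_mor[OF z g]
  have "g \<cdot> Zero C A B \<oplus> g \<cdot> Zero C A B = g \<cdot> Zero C A B \<oplus> Zero C A D"
    using comp_plus_left[OF z z g] zero_plus[OF z] plus_zero[OF gz] by simp
  then show ?thesis by (rule plus_left_cancel[OF gz gz zero_mor[OF A mor_cod[OF g]]])
qed

lemma comp_zero_left:
  assumes f: "f \<in> Mor C A B" and D: "D \<in> Obj C" shows "Zero C B D \<cdot> f = Zero C A D"
proof -
  have z: "Zero C B D \<in> Mor C B D" by (rule zero_mor[OF mor_cod[OF f] D])
  note zf = comp_mor[OF f z]
  have "Zero C B D \<cdot> f \<oplus> Zero C B D \<cdot> f = Zero C B D \<cdot> f \<oplus> Zero C A D"
    using comp_plus_right[OF f z z] zero_plus[OF z] plus_zero[OF zf] by simp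
  then show ?thesis by (rule plus_left_cancel[OF zf zf zero_mor[OF mor_dom[OF f] D]])
qed

lemma comp_neg_right:
  assumes f: "f \<in> Mor C A B" and g: "g \<in> Mor C B D"
  shows "g \<cdot> Neg C f = Neg C (g \<cdot> f)"
proof (rule plus_left_cancel)
  show gf: "g \<cdot> f \<in> Mor C A D" by (rule comp_mor[OF f g])
  show "g \<cdot> Neg C f \<in> Mor C A D" by (rule comp_mor[OF neg_mor[OF f] g])
  show "Neg C (g \<cdot> f) \<in> Mor C A D" by (rule neg_mor[OF gf])
  show "g \<cdot> f \<oplus> g \<cdot> Neg C f = g \<cdot> f \<oplus> Neg C (g \<cdot> f)"
    using comp_plus_left[OF f neg_mor[OF f] g] plus_neg[OF f] plus_neg[OF gf]
      comp_zero_right[OF g mor_dom[OF f]] by simp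
qed

lemma comp_neg_left:
  assumes f: "f \<in> Mor C A B" and g: "g \<in> Mor C B D"
  shows "Neg C g \<cdot> f = Neg C (g \<cdot> f)"
proof (rule plus_left_cancel)
  show gf: "g \<cdot> f \<in> Mor C A D" by (rule comp_mor[OF f g])
  show "Neg C g \<cdot> f \<in> Mor C A D" by (rule comp_mor[OF f neg_mor[OF g]])
  show "Neg C (g \<cdot> f) \<in> Mor C A D" by (rule neg_mor[OF gf])
  show "g \<cdot> f \<oplus> Neg C g \<cdot> f = g \<cdot> f \<oplus> Neg C (g \<cdot> f)"
    using comp_plus_right[OF f g neg_mor[OF g]] plus_neg[OF g] plus_neg[OF gf]
      comp_zero_left[OF f mor_cod[OF g]] by simp
qed

lemma neg_zero:
  assumes "A \<in> Obj C" "B \<in> Obj C" shows "Neg C (Zero C A B) = Zero C A B"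
  using neg_plus[OF zero_mor[OF assms]] plus_zero[OF neg_mor[OF zero_mor[OF assms]]] by simp

lemma zero_if_neg_zero:
  assumes f: "f \<in> Mor C A B" and "Neg C f = Zero C A B" shows "f = Zero C A B"
  using plus_neg[OF f] plus_zero[OF f] assms(2) by simp

lemma diff_plus_cancel:
  assumes f: "f \<in> Mor C A B" and g: "g \<in> Mor C A B" shows "(f \<oplus> Neg C g) \<oplus> g = f"
  using plus_assoc[OF f neg_mor[OF g] g] neg_plus[OF g] plus_zero[OF f] by simp

lemma comp_diff:
  assumes "f \<in> Mor C A B" "f' \<in> Mor C A B" "g \<in> Mor C B D"
  shows "g \<cdot> (f \<oplus> Neg C f') = (g \<cdot> f) \<oplus> Neg C (g \<cdot> f')"
  using comp_plus_left[OF assms(1) neg_mor[OF assms(2)] assms(3)]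
    comp_neg_right[OF assms(2,3)] by simp

lemma mor_to_zero_object:
  assumes "is_zero_object C N" "f \<in> Mor C A N" shows "f = Zero C A N"
proof -
  have "A \<in> Obj C" "N \<in> Obj C" by (rule mor_dom[OF assms(2)], rule mor_cod[OF assms(2)])
  then show ?thesis
    using assms zero_mor[of A N] unfolding is_zero_object_def by (metis (no_types))
qed

text \<open>Splitting the identity of \<open>P\<close> yields maps \<open>r\<close> and \<open>p\<close> back to \<open>A\<close> and \<open>B\<close>, and uniqueness of
  decompositions gives the biproduct equations. So maps out of \<open>P\<close> are determined by, and can be
  assembled from, their components.\<close>

lemma is_coproduct_if_hom_sum:
  assumes sum: "is_hom_sum C A B P i j" shows "is_coproduct C A B P i j"
proof -
  have i: "i \<in> Mor C A P" and j: "j \<in> Mor C B P" using sum by (auto simp: is_hom_sum_def)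
  note gen = hom_sum_split[OF sum] and ker = hom_sum_unique[OF sum]
  note A = mor_dom[OF i] and B = mor_dom[OF j] and P = mor_cod[OF i]
  have uniq: "a = a' \<and> b = b'"
    if m: "a \<in> Mor C Q A" "a' \<in> Mor C Q A" "b \<in> Mor C Q B" "b' \<in> Mor C Q B"
      and eq: "(i \<cdot> a) \<oplus> (j \<cdot> b) = (i \<cdot> a') \<oplus> (j \<cdot> b')" for Q a a' b b'
  proof -
    note na = neg_mor[OF m(2)] and nb = neg_mor[OF m(4)]
    note ia = comp_mor[OF m(1) i] and ia' = comp_mor[OF m(2) i]
      and jb = comp_mor[OF m(3) j] and jb' = comp_mor[OF m(4) j]
    have "(i \<cdot> (a \<oplus> Neg C a')) \<oplus> (j \<cdot> (b \<oplus> Neg C b'))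
        = ((i \<cdot> a) \<oplus> Neg C (i \<cdot> a')) \<oplus> ((j \<cdot> b) \<oplus> Neg C (j \<cdot> b'))"
      using m na nb i j by (simp add: comp_plus_left comp_neg_right)
    also have "\<dots> = ((i \<cdot> a) \<oplus> (j \<cdot> b)) \<oplus> (Neg C (i \<cdot> a') \<oplus> Neg C (j \<cdot> b'))"
      using plus_interchange[OF ia neg_mor[OF ia'] jb neg_mor[OF jb']] .
    also have "\<dots> = ((i \<cdot> a') \<oplus> (j \<cdot> b')) \<oplus> (Neg C (i \<cdot> a') \<oplus> Neg C (j \<cdot> b'))"
      using eq by simp
    also have "\<dots> = ((i \<cdot> a') \<oplus> Neg C (i \<cdot> a')) \<oplus> ((j \<cdot> b') \<oplus> Neg C (j \<cdot> b'))"
      using plus_interchange[OF ia' jb' neg_mor[OF ia'] neg_mor[OF jb']] .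
    also have "\<dots> = Zero C Q P"
      using plus_neg[OF ia'] plus_neg[OF jb'] zero_plus[OF zero_mor[OF mor_dom[OF m(1)] P]] by simp
    finally have "a \<oplus> Neg C a' = Zero C Q A" "b \<oplus> Neg C b' = Zero C Q B"
      using ker[OF plus_mor[OF m(1) na] plus_mor[OF m(3) nb]] by simp_all
    then show ?thesis by (metis (no_types) eq_if_diff_zero m)
  qed
  obtain r p where r: "r \<in> Mor C P A" and p: "p \<in> Mor C P B"
    and id: "Ident C P = (i \<cdot> r) \<oplus> (j \<cdot> p)"
    by (rule gen[OF ident_mor[OF P]])
  note ir = comp_mor[OF r i] and jp = comp_mor[OF p j]
  have split: "y = (i \<cdot> (r \<cdot> y)) \<oplus> (j \<cdot> (p \<cdot> y))" if y: "y \<in> Mor C Q P" for Q y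
    using comp_plus_right[OF y ir jp] id comp_ident_left[OF y] comp_assoc[OF y r i]
      comp_assoc[OF y p j] by simp
  have "(i \<cdot> (r \<cdot> i)) \<oplus> (j \<cdot> (p \<cdot> i)) = (i \<cdot> Ident C A) \<oplus> (j \<cdot> Zero C A B)"
    using split[OF i] comp_ident_right[OF i] comp_zero_right[OF j A] plus_zero[OF i] by simp
  then have ri: "r \<cdot> i = Ident C A" and pi: "p \<cdot> i = Zero C A B"
    using uniq[OF comp_mor[OF i r] ident_mor[OF A] comp_mor[OF i p] zero_mor[OF A B]] by auto
  have "(i \<cdot> (r \<cdot> j)) \<oplus> (j \<cdot> (p \<cdot> j)) = (i \<cdot> Zero C B A) \<oplus> (j \<cdot> Ident C B)"
    using split[OF j] comp_ident_right[OF j] comp_zero_right[OF i B] zero_plus[OF j] by simp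
  then have rj: "r \<cdot> j = Zero C B A" and pj: "p \<cdot> j = Ident C B"
    using uniq[OF comp_mor[OF j r] zero_mor[OF B A] comp_mor[OF j p] ident_mor[OF B]] by auto
  have "\<exists>!h. h \<in> Mor C P Q \<and> h \<cdot> i = f \<and> h \<cdot> j = g"
    if f: "f \<in> Mor C A Q" and g: "g \<in> Mor C B Q" for Q f g
  proof (rule ex1I)
    let ?h = "(f \<cdot> r) \<oplus> (g \<cdot> p)"
    note fr = comp_mor[OF r f] and gp = comp_mor[OF p g]
    have "?h \<cdot> i = (f \<cdot> (r \<cdot> i)) \<oplus> (g \<cdot> (p \<cdot> i))"
      using comp_plus_right[OF i fr gp] comp_assoc[OF i r f] comp_assoc[OF i p g] by simp
    moreover have "?h \<cdot> j = (f \<cdot> (r \<cdot> j)) \<oplus> (g \<cdot> (p \<cdot> j))"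
      using comp_plus_right[OF j fr gp] comp_assoc[OF j r f] comp_assoc[OF j p g] by simp
    ultimately show "?h \<in> Mor C P Q \<and> ?h \<cdot> i = f \<and> ?h \<cdot> j = g"
      using plus_mor[OF fr gp] ri pi rj pj comp_ident_right[OF f] comp_ident_right[OF g]
        comp_zero_right[OF f B] comp_zero_right[OF g A] plus_zero[OF f] zero_plus[OF g]
      by simp
  next
    fix h assume h: "h \<in> Mor C P Q \<and> h \<cdot> i = f \<and> h \<cdot> j = g"
    then have m: "h \<in> Mor C P Q" by simp
    have "h = h \<cdot> ((i \<cdot> r) \<oplus> (j \<cdot> p))" using id comp_ident_right[OF m] by simp
    also have "\<dots> = (h \<cdot> (i \<cdot> r)) \<oplus> (h \<cdot> (j \<cdot> p))" by (rule comp_plus_left[OF ir jp m])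
    also have "\<dots> = (f \<cdot> r) \<oplus> (g \<cdot> p)"
      using comp_assoc[OF r i m] comp_assoc[OF p j m] h by simp
    finally show "h = (f \<cdot> r) \<oplus> (g \<cdot> p)" .
  qed
  then show ?thesis using i j unfolding is_coproduct_def by blast
qed

lemma is_coproduct_iso_zero_object:
  assumes iso: "is_isomorphism C A P i" and N: "is_zero_object C N"
  shows "is_coproduct C A N P i (Zero C N P)"
proof -
  obtain k where i: "i \<in> Mor C A P" and k: "k \<in> Mor C P A"
    and ki: "k \<cdot> i = Ident C A" and ik: "i \<cdot> k = Ident C P"
    using iso by (auto simp: is_isomorphism_def inverse_arrows_def)
  have O: "N \<in> Obj C" using N by (simp add: is_zero_object_def)
  note P = mor_cod[OF i]
  have zNP: "Zero C N P \<in> Mor C N P" by (rule zero_mor[OF O P])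
  have z: "Zero C N P \<cdot> b = Zero C Q P" if "b \<in> Mor C Q N" for Q b
    using comp_zero_left[OF that P] .
  have "\<exists>a \<in> Mor C Q A. \<exists>b \<in> Mor C Q N. y = (i \<cdot> a) \<oplus> (Zero C N P \<cdot> b)"
    if y: "y \<in> Mor C Q P" for Q y
  proof (intro bexI)
    show "k \<cdot> y \<in> Mor C Q A" "Zero C Q N \<in> Mor C Q N"
      by (rule comp_mor[OF y k], rule zero_mor[OF mor_dom[OF y] O])
    then show "y = (i \<cdot> (k \<cdot> y)) \<oplus> (Zero C N P \<cdot> Zero C Q N)"
      using z comp_assoc[OF y k i] ik comp_ident_left[OF y] plus_zero[OF y] by simp
  qed
  moreover have "a = Zero C Q A \<and> b = Zero C Q N"
    if a: "a \<in> Mor C Q A" and b: "b \<in> Mor C Q N"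
      and eq: "(i \<cdot> a) \<oplus> (Zero C N P \<cdot> b) = Zero C Q P" for Q a b
  proof -
    have "i \<cdot> a = Zero C Q P" using eq z[OF b] plus_zero[OF comp_mor[OF a i]] by simp
    then have "k \<cdot> (i \<cdot> a) = Zero C Q A" using comp_zero_right[OF k mor_dom[OF a]] by simp
    then show ?thesis
      using comp_assoc[OF a i k] ki comp_ident_left[OF a] mor_to_zero_object[OF N b] by simp
  qed
  ultimately have "is_hom_sum C A N P i (Zero C N P)"
    using i zNP unfolding is_hom_sum_def by blast
  then show ?thesis by (rule is_coproduct_if_hom_sum)
qed

end

lemma (in additive_functor) amap_zero:
  assumes "A \<in> Obj D" "B \<in> Obj D"
  shows "amap F (Zero D A B) = Zero E (omap F A) (omap F B)"
proof (rule E.plus_left_cancel)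
  have z: "Zero D A B \<in> Mor D A B" by (rule D.zero_mor[OF assms])
  show m: "amap F (Zero D A B) \<in> Mor E (omap F A) (omap F B)"
    using z by (rule amap_mor)
  then show "amap F (Zero D A B) \<in> Mor E (omap F A) (omap F B)" .
  show "Zero E (omap F A) (omap F B) \<in> Mor E (omap F A) (omap F B)"
    by (rule E.zero_mor[OF assms[THEN omap_obj]])
  show "amap F (Zero D A B) \<oplus>\<^bsub>E\<^esub> amap F (Zero D A B)
      = amap F (Zero D A B) \<oplus>\<^bsub>E\<^esub> Zero E (omap F A) (omap F B)"
    using amap_plus[OF z z] D.zero_plus[OF z] E.plus_zero[OF m] by simp
qed

section \<open>Exact triangles and homological functors\<close>

context triangulated_category
begin

lemma exact_mors:
  assumes "Triangle X Y Z f g h \<in> Exact C"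
  shows "f \<in> Mor C X Y" "g \<in> Mor C Y Z" "h \<in> Mor C Z (\<Sigma>\<^sub>o X)"
  using exact_is_triangle[OF assms] by simp_all

lemma shift_inject:
  assumes "f \<in> Mor C A B" "g \<in> Mor C A B" "\<Sigma>\<^sub>m f = \<Sigma>\<^sub>m g" shows "f = g"
  using shift_fully_faithful assms mor_dom[OF assms(1)] mor_cod[OF assms(1)]
  unfolding fully_faithful_def bij_betw_def inj_on_def by blast

lemma shift_full:
  assumes "A \<in> Obj C" "B \<in> Obj C" "h \<in> Mor C (\<Sigma>\<^sub>o A) (\<Sigma>\<^sub>o B)"
  obtains f where "f \<in> Mor C A B" "h = \<Sigma>\<^sub>m f"
  using shift_fully_faithful assms unfolding fully_faithful_def bij_betw_def by blast

lemma exact_rotate: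
  assumes "Triangle X Y Z f g h \<in> Exact C"
  shows "Triangle Y Z (\<Sigma>\<^sub>o X) g h (Neg C (\<Sigma>\<^sub>m f)) \<in> Exact C"
  using exact_rotation exact_is_triangle assms by blast

text \<open>The identity of \<open>X\<close> and \<open>f\<close> extend to a morphism from \<open>X \<rightarrow> X \<rightarrow> 0\<close>, through whose last term
  \<open>g \<cdot> f\<close> then factors.\<close>

lemma exact_comp_zero:
  assumes ex: "Triangle X Y Z f g h \<in> Exact C" shows "g \<cdot> f = Zero C X Z"
proof -
  note m = exact_mors[OF ex]
  note X = mor_dom[OF m(1)]
  obtain N where N: "is_zero_object C N" using ex_zero_object by blast
  have "f \<cdot> Ident C X = f \<cdot> Ident C X" ..
  from exact_mor_completion[OF exact_ident[OF X N] ex ident_mor[OF X] m(1) this]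
  obtain w where "w \<in> Mor C N Z" "w \<cdot> Zero C X N = g \<cdot> f" by auto
  then show ?thesis using comp_zero_right[OF _ X] by metis
qed

text \<open>The maps \<open>y\<close> and \<open>0 \<rightarrow> Z\<close> form a commutative square between the rotations of \<open>Q \<rightarrow> Q \<rightarrow> 0\<close> and
  of the given triangle. The third component of an extension of it is a map \<open>Q[1] \<rightarrow> X[1]\<close>, and the
  factorisation is obtained by undoing the shift.\<close>

lemma exact_weak_kernel:
  assumes ex: "Triangle X Y Z f g h \<in> Exact C" and y: "y \<in> Mor C Q Y"
    and gy: "g \<cdot> y = Zero C Q Z"
  obtains x where "x \<in> Mor C Q X" "y = f \<cdot> x"
proof -
  note m = exact_mors[OF ex]
  note Q = mor_dom[OF y] and X = mor_dom[OF m(1)] and Z = mor_cod[OF m(2)]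
  obtain N where N: "is_zero_object C N" using ex_zero_object by blast
  then have "N \<in> Obj C" by (simp add: is_zero_object_def)
  note z = zero_mor[OF this Z] and z' = zero_mor[OF Q this]
  have "Zero C N Z \<cdot> Zero C Q N = g \<cdot> y" using comp_zero_right[OF z Q] gy by simp
  from exact_mor_completion[OF exact_rotate[OF exact_ident[OF Q N]] exact_rotate[OF ex] y z this]
  obtain w where w: "w \<in> Mor C (\<Sigma>\<^sub>o Q) (\<Sigma>\<^sub>o X)"
    and eq: "\<Sigma>\<^sub>m y \<cdot> Neg C (\<Sigma>\<^sub>m (Ident C Q)) = Neg C (\<Sigma>\<^sub>m f) \<cdot> w" by auto
  obtain x where x: "x \<in> Mor C Q X" and wx: "w = \<Sigma>\<^sub>m x" by (rule shift_full[OF Q X w])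
  have "Neg C (\<Sigma>\<^sub>m y) = \<Sigma>\<^sub>m y \<cdot> Neg C (\<Sigma>\<^sub>m (Ident C Q))"
    using comp_neg_right[OF shift.amap_mor[OF ident_mor[OF Q]] shift.amap_mor[OF y]]
      shift.amap_comp[OF ident_mor[OF Q] y] comp_ident_right[OF y] by simp
  also have "\<dots> = Neg C (\<Sigma>\<^sub>m (f \<cdot> x))"
    using eq wx comp_neg_left[OF shift.amap_mor[OF x] shift.amap_mor[OF m(1)]]
      shift.amap_comp[OF x m(1)] by simp
  finally have "\<Sigma>\<^sub>m y = \<Sigma>\<^sub>m (f \<cdot> x)"
    by (rule neg_inject[OF shift.amap_mor[OF y] shift.amap_mor[OF comp_mor[OF x m(1)]]])
  then have "y = f \<cdot> x" by (rule shift_inject[OF y comp_mor[OF x m(1)]])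
  then show thesis using that x by blast
qed

lemma exact_comp_zero_shift:
  assumes ex: "Triangle X Y Z f g h \<in> Exact C" shows "\<Sigma>\<^sub>m f \<cdot> h = Zero C Z (\<Sigma>\<^sub>o Y)"
proof (rule zero_if_neg_zero)
  note m = exact_mors[OF ex]
  show "\<Sigma>\<^sub>m f \<cdot> h \<in> Mor C Z (\<Sigma>\<^sub>o Y)" by (rule comp_mor[OF m(3) shift.amap_mor[OF m(1)]])
  show "Neg C (\<Sigma>\<^sub>m f \<cdot> h) = Zero C Z (\<Sigma>\<^sub>o Y)"
    using exact_comp_zero[OF exact_rotate[OF exact_rotate[OF ex]]]
      comp_neg_left[OF m(3) shift.amap_mor[OF m(1)]] by simp
qed

lemma exact_weak_kernel_shift:
  assumes ex: "Triangle X Y Z f g h \<in> Exact C" and s: "s \<in> Mor C Q (\<Sigma>\<^sub>o X)"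
    and fs: "\<Sigma>\<^sub>m f \<cdot> s = Zero C Q (\<Sigma>\<^sub>o Y)"
  obtains t where "t \<in> Mor C Q Z" "s = h \<cdot> t"
proof (rule exact_weak_kernel[OF exact_rotate[OF exact_rotate[OF ex]] s])
  note f = shift.amap_mor[OF exact_mors(1)[OF ex]]
  show "Neg C (\<Sigma>\<^sub>m f) \<cdot> s = Zero C Q (\<Sigma>\<^sub>o Y)"
    using comp_neg_left[OF s f] fs neg_zero[OF mor_dom[OF s] mor_cod[OF f]] by simp
qed

text \<open>The identity of \<open>Z\<close> is annihilated by \<open>h\<close>, so it lifts along \<open>g\<close>.\<close>

lemma retraction_if_third_zero:
  assumes ex: "Triangle X Y Z f g h \<in> Exact C" and h0: "h = Zero C Z (\<Sigma>\<^sub>o X)"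
  shows "is_retraction C Y Z g"
proof -
  note m = exact_mors[OF ex]
  have id: "Ident C Z \<in> Mor C Z Z" by (rule ident_mor[OF mor_dom[OF m(3)]])
  obtain k where "k \<in> Mor C Z Y" "Ident C Z = g \<cdot> k"
    using exact_weak_kernel[OF exact_rotate[OF ex] id] comp_ident_right[OF m(3)] h0 by metis
  then show ?thesis unfolding is_retraction_def using m(2) by metis
qed

text \<open>The completion axiom supplies the third component; the first one is obtained by applying it to
  the rotated triangles and removing the shift, which is full and faithful.\<close>

lemma exact_mor_completion_first:
  assumes ex: "Triangle X Y Z f g h \<in> Exact C" and ex': "Triangle X' Y' Z' f' g' h' \<in> Exact C"
    and v: "v \<in> Mor C Y Y'" and w: "w \<in> Mor C Z Z'" and eq: "w \<cdot> g = g' \<cdot> v"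
  obtains u where
    "triangle_mor C (Triangle X Y Z f g h) (Triangle X' Y' Z' f' g' h') u v w"
proof -
  note m = exact_mors[OF ex] and m' = exact_mors[OF ex']
  note X = mor_dom[OF m(1)] and X' = mor_dom[OF m'(1)]
  obtain s where s: "s \<in> Mor C (\<Sigma>\<^sub>o X) (\<Sigma>\<^sub>o X')" and sh: "s \<cdot> h = h' \<cdot> w"
    and sf: "\<Sigma>\<^sub>m v \<cdot> Neg C (\<Sigma>\<^sub>m f) = Neg C (\<Sigma>\<^sub>m f') \<cdot> s"
    using exact_mor_completion[OF exact_rotate[OF ex] exact_rotate[OF ex'] v w eq] by auto
  obtain u where u: "u \<in> Mor C X X'" and su: "s = \<Sigma>\<^sub>m u" by (rule shift_full[OF X X' s])
  note vf = comp_mor[OF m(1) v] and fu = comp_mor[OF u m'(1)]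
  have "Neg C (\<Sigma>\<^sub>m (v \<cdot> f)) = \<Sigma>\<^sub>m v \<cdot> Neg C (\<Sigma>\<^sub>m f)"
    using comp_neg_right[OF shift.amap_mor[OF m(1)] shift.amap_mor[OF v]]
      shift.amap_comp[OF m(1) v] by simp
  also have "\<dots> = Neg C (\<Sigma>\<^sub>m (f' \<cdot> u))"
    using sf su comp_neg_left[OF shift.amap_mor[OF u] shift.amap_mor[OF m'(1)]]
      shift.amap_comp[OF u m'(1)] by simp
  finally have "\<Sigma>\<^sub>m (v \<cdot> f) = \<Sigma>\<^sub>m (f' \<cdot> u)"
    by (rule neg_inject[OF shift.amap_mor[OF vf] shift.amap_mor[OF fu]])
  then have "v \<cdot> f = f' \<cdot> u" by (rule shift_inject[OF vf fu])
  then show thesis using that u v w eq sh su m m' by simp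
qed

text \<open>In a triangle \<open>X \<rightarrow> P \<rightarrow> W \<rightarrow> X[1]\<close> starting with a section \<open>i\<close>, the last map \<open>q\<close> is zero, because
  \<open>i[1] \<cdot> q = 0\<close> and \<open>i[1]\<close> has a left inverse. So \<open>P \<rightarrow> W\<close> has a right inverse \<open>j\<close>, which embeds the
  complement.\<close>

lemma section_complement:
  assumes "is_section C X P i"
  shows "\<exists>W j. is_hom_sum C X W P i j"
proof -
  obtain r where i: "i \<in> Mor C X P" and r: "r \<in> Mor C P X" and ri: "r \<cdot> i = Ident C X"
    using assms unfolding is_section_def by blast
  obtain W p q where ex: "Triangle X P W i p q \<in> Exact C" using exact_completion[OF i] by blast
  note m = exact_mors[OF ex]
  note X = mor_dom[OF i]
  have "q = \<Sigma>\<^sub>m (r \<cdot> i) \<cdot> q" using ri shift.amap_ident[OF X] comp_ident_left[OF m(3)] by simp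
  also have "\<dots> = \<Sigma>\<^sub>m r \<cdot> (\<Sigma>\<^sub>m i \<cdot> q)"
    using shift.amap_comp[OF i r]
      comp_assoc[OF m(3) shift.amap_mor[OF i] shift.amap_mor[OF r]] by simp
  also have "\<dots> = Zero C W (\<Sigma>\<^sub>o X)"
    using exact_comp_zero_shift[OF ex] comp_zero_right[OF shift.amap_mor[OF r] mor_dom[OF m(3)]]
    by simp
  finally have "is_retraction C P W p" by (rule retraction_if_third_zero[OF ex])
  then obtain j where j: "j \<in> Mor C W P" and pj: "p \<cdot> j = Ident C W"
    unfolding is_retraction_def by blast
  have "\<exists>a \<in> Mor C Q X. \<exists>b \<in> Mor C Q W. y = (i \<cdot> a) \<oplus> (j \<cdot> b)" if y: "y \<in> Mor C Q P" for Q y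
  proof -
    note py = comp_mor[OF y m(2)]
    note jpy = comp_mor[OF py j]
    have "p \<cdot> (y \<oplus> Neg C (j \<cdot> (p \<cdot> y))) = (p \<cdot> y) \<oplus> Neg C (p \<cdot> (j \<cdot> (p \<cdot> y)))"
      by (rule comp_diff[OF y jpy m(2)])
    also have "p \<cdot> (j \<cdot> (p \<cdot> y)) = p \<cdot> y"
      using comp_assoc[OF py j m(2)] pj comp_ident_left[OF py] by simp
    finally have "p \<cdot> (y \<oplus> Neg C (j \<cdot> (p \<cdot> y))) = Zero C Q W" using plus_neg[OF py] by simp
    then obtain a where "a \<in> Mor C Q X" "y \<oplus> Neg C (j \<cdot> (p \<cdot> y)) = i \<cdot> a"
      by (rule exact_weak_kernel[OF ex plus_mor[OF y neg_mor[OF jpy]]])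
    then show ?thesis using diff_plus_cancel[OF y jpy] py by metis
  qed
  moreover have "a = Zero C Q X \<and> b = Zero C Q W"
    if a: "a \<in> Mor C Q X" and b: "b \<in> Mor C Q W" and eq: "(i \<cdot> a) \<oplus> (j \<cdot> b) = Zero C Q P"
    for Q a b
  proof -
    note Q = mor_dom[OF a] and ia = comp_mor[OF a i] and jb = comp_mor[OF b j]
    have "p \<cdot> ((i \<cdot> a) \<oplus> (j \<cdot> b)) = Zero C Q W" unfolding eq by (rule comp_zero_right[OF m(2) Q])
    moreover have "p \<cdot> (i \<cdot> a) = Zero C Q W"
      using comp_assoc[OF a i m(2)] exact_comp_zero[OF ex] comp_zero_left[OF a mor_cod[OF m(2)]]
      by simp
    moreover have "p \<cdot> (j \<cdot> b) = b" using comp_assoc[OF b j m(2)] pj comp_ident_left[OF b] by simp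
    ultimately have b0: "b = Zero C Q W" using comp_plus_left[OF ia jb m(2)] zero_plus[OF b] by simp
    have "i \<cdot> a = Zero C Q P" using eq b0 comp_zero_right[OF j Q] plus_zero[OF ia] by simp
    then have "r \<cdot> (i \<cdot> a) = Zero C Q X" using comp_zero_right[OF r Q] by simp
    then have "a = Zero C Q X" using comp_assoc[OF a i r] ri comp_ident_left[OF a] by simp
    then show ?thesis using b0 by blast
  qed
  ultimately show ?thesis using i j unfolding is_hom_sum_def by blast
qed

end

text \<open>The part of the exactness of \<open>Hom(Q, -)\<close> that a comparison of the middle terms needs. The last
  clause concerns maps \<open>Q[1] \<rightarrow> X[1]\<close> annihilated by \<open>f[1]\<close>: since the shift is fully faithful, each of
  them is \<open>x[1]\<close> for a unique \<open>x\<close> annihilated by \<open>f\<close>.\<close>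

fun hom_exact :: "('o, 'm, 'b) triang_cat_scheme \<Rightarrow> ('o, 'm) triangle \<Rightarrow> bool" where
  "hom_exact C (Triangle X Y Z f g h) \<longleftrightarrow> is_triangle C (Triangle X Y Z f g h) \<and>
     g \<cdot>\<^bsub>C\<^esub> f = Zero C X Z \<and> h \<cdot>\<^bsub>C\<^esub> g = Zero C Y (\<Sigma>\<^sub>o\<^bsub>C\<^esub> X) \<and>
     (\<forall>Q. \<forall>y \<in> Mor C Q Y. g \<cdot>\<^bsub>C\<^esub> y = Zero C Q Z \<longrightarrow> (\<exists>x \<in> Mor C Q X. y = f \<cdot>\<^bsub>C\<^esub> x)) \<and>
     (\<forall>Q. \<forall>x \<in> Mor C Q X. f \<cdot>\<^bsub>C\<^esub> x = Zero C Q Y \<longrightarrow>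
        (\<exists>t \<in> Mor C (\<Sigma>\<^sub>o\<^bsub>C\<^esub> Q) Z. \<Sigma>\<^sub>m\<^bsub>C\<^esub> x = h \<cdot>\<^bsub>C\<^esub> t))"

context triangulated_category
begin

text \<open>A complement \<open>j : W \<rightarrow> P\<^sub>1\<close> of \<open>i\<^sub>1\<close> gives the complement \<open>a \<cdot> j\<close> of \<open>i\<^sub>2\<close>. This is the five lemma
  for \<open>Hom(Q, -)\<close> applied to \<open>X \<oplus> W \<rightarrow> Y \<oplus> W \<rightarrow> Z\<close> and \<open>P\<^sub>1 \<rightarrow> P\<^sub>2 \<rightarrow> P\<^sub>3\<close>, carried out on elements.\<close>

lemma triangle_summand_if_section:
  assumes ex: "Triangle X Y Z f g h \<in> Exact C"
    and hex: "hom_exact C (Triangle P\<^sub>1 P\<^sub>2 P\<^sub>3 a b c)"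
    and mor: "triangle_mor C (Triangle X Y Z f g h) (Triangle P\<^sub>1 P\<^sub>2 P\<^sub>3 a b c) i\<^sub>1 i\<^sub>2 i\<^sub>3"
    and sec: "is_section C X P\<^sub>1 i\<^sub>1"
    and iso: "is_isomorphism C Z P\<^sub>3 i\<^sub>3"
    and N: "is_zero_object C N"
  shows "\<exists>W \<in> Obj C. \<exists>j\<^sub>1 j\<^sub>2 j\<^sub>3. is_triangle_coproduct C (Triangle X Y Z f g h)
    (Triangle W W N (Ident C W) (Zero C W N) (Zero C N (\<Sigma>\<^sub>o W)))
    (Triangle P\<^sub>1 P\<^sub>2 P\<^sub>3 a b c) (i\<^sub>1, i\<^sub>2, i\<^sub>3) (j\<^sub>1, j\<^sub>2, j\<^sub>3)"
proof -
  note m = exact_mors[OF ex]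
  have a: "a \<in> Mor C P\<^sub>1 P\<^sub>2" and b: "b \<in> Mor C P\<^sub>2 P\<^sub>3" and c: "c \<in> Mor C P\<^sub>3 (\<Sigma>\<^sub>o P\<^sub>1)"
    and ba: "b \<cdot> a = Zero C P\<^sub>1 P\<^sub>3" and cb: "c \<cdot> b = Zero C P\<^sub>2 (\<Sigma>\<^sub>o P\<^sub>1)"
    using hex by auto
  have ker_b: "\<exists>x \<in> Mor C Q P\<^sub>1. y = a \<cdot> x"
    if "y \<in> Mor C Q P\<^sub>2" "b \<cdot> y = Zero C Q P\<^sub>3" for Q y
    using hex that by simp
  have ker_a: "\<exists>t \<in> Mor C (\<Sigma>\<^sub>o Q) P\<^sub>3. \<Sigma>\<^sub>m x = c \<cdot> t"
    if "x \<in> Mor C Q P\<^sub>1" "a \<cdot> x = Zero C Q P\<^sub>2" for Q x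
    using hex that by simp
  have i1: "i\<^sub>1 \<in> Mor C X P\<^sub>1" and i2: "i\<^sub>2 \<in> Mor C Y P\<^sub>2" and i3: "i\<^sub>3 \<in> Mor C Z P\<^sub>3"
    and sq1: "i\<^sub>2 \<cdot> f = a \<cdot> i\<^sub>1" and sq2: "i\<^sub>3 \<cdot> g = b \<cdot> i\<^sub>2" and sq3: "\<Sigma>\<^sub>m i\<^sub>1 \<cdot> h = c \<cdot> i\<^sub>3"
    using mor by auto
  note P1 = mor_dom[OF a] and P2 = mor_cod[OF a] and P3 = mor_cod[OF b] and X = mor_dom[OF m(1)]
    and Y = mor_dom[OF m(2)] and SX = mor_cod[OF m(3)] and SP1 = mor_cod[OF c]
  obtain k where k: "k \<in> Mor C P\<^sub>3 Z" and ki: "k \<cdot> i\<^sub>3 = Ident C Z" and ik: "i\<^sub>3 \<cdot> k = Ident C P\<^sub>3"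
    using iso by (auto simp: is_isomorphism_def inverse_arrows_def)
  obtain r where r: "r \<in> Mor C P\<^sub>1 X" and ri: "r \<cdot> i\<^sub>1 = Ident C X"
    using sec by (auto simp: is_section_def)
  obtain W j where sum: "is_hom_sum C X W P\<^sub>1 i\<^sub>1 j" using section_complement[OF sec] by blast
  then have j: "j \<in> Mor C W P\<^sub>1" by (simp add: is_hom_sum_def)
  note W = mor_dom[OF j] and aj = comp_mor[OF j a]
  have shift_i_mono: "z = Zero C Q (\<Sigma>\<^sub>o X)"
    if z: "z \<in> Mor C Q (\<Sigma>\<^sub>o X)" and 0: "\<Sigma>\<^sub>m i\<^sub>1 \<cdot> z = Zero C Q (\<Sigma>\<^sub>o P\<^sub>1)" for Q z
  proof -
    note si = shift.amap_mor[OF i1] and sr = shift.amap_mor[OF r]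
    have "z = \<Sigma>\<^sub>m (r \<cdot> i\<^sub>1) \<cdot> z" using ri shift.amap_ident[OF X] comp_ident_left[OF z] by simp
    also have "\<dots> = \<Sigma>\<^sub>m r \<cdot> (\<Sigma>\<^sub>m i\<^sub>1 \<cdot> z)" using shift.amap_comp[OF i1 r] comp_assoc[OF z si sr] by simp
    also have "\<dots> = Zero C Q (\<Sigma>\<^sub>o X)" unfolding 0 by (rule comp_zero_right[OF sr mor_dom[OF z]])
    finally show ?thesis .
  qed
  have "\<exists>y' \<in> Mor C Q Y. \<exists>w \<in> Mor C Q W. y = (i\<^sub>2 \<cdot> y') \<oplus> ((a \<cdot> j) \<cdot> w)"
    if y: "y \<in> Mor C Q P\<^sub>2" for Q y
  proof -
    note Q = mor_dom[OF y] and by_mor = comp_mor[OF y b]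
    \<comment> \<open>The image of \<open>y\<close> in \<open>Z\<close> lifts to some \<open>y'\<close>, because \<open>c \<cdot> b = 0\<close> and \<open>i\<^sub>1[1]\<close> is mono. Then
      \<open>y\<close> and \<open>i\<^sub>2 \<cdot> y'\<close> differ by a map from \<open>P\<^sub>1\<close>, which decomposes.\<close>
    let ?z = "k \<cdot> (b \<cdot> y)"
    have z: "?z \<in> Mor C Q Z" by (rule comp_mor[OF by_mor k])
    have iz: "i\<^sub>3 \<cdot> ?z = b \<cdot> y" using comp_assoc[OF by_mor k i3] ik comp_ident_left[OF by_mor] by simp
    have "\<Sigma>\<^sub>m i\<^sub>1 \<cdot> (h \<cdot> ?z) = (c \<cdot> i\<^sub>3) \<cdot> ?z"
      using comp_assoc[OF z m(3) shift.amap_mor[OF i1]] sq3 by simp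
    also have "\<dots> = c \<cdot> (b \<cdot> y)" using comp_assoc[OF z i3 c] iz by simp
    also have "\<dots> = Zero C Q (\<Sigma>\<^sub>o P\<^sub>1)" using comp_assoc[OF y b c] cb comp_zero_left[OF y SP1] by simp
    finally have "h \<cdot> ?z = Zero C Q (\<Sigma>\<^sub>o X)" by (rule shift_i_mono[OF comp_mor[OF z m(3)]])
    then obtain y' where y': "y' \<in> Mor C Q Y" and zy: "?z = g \<cdot> y'"
      by (rule exact_weak_kernel[OF exact_rotate[OF ex] z])
    note iy = comp_mor[OF y' i2]
    have "b \<cdot> (i\<^sub>2 \<cdot> y') = b \<cdot> y"
      using comp_assoc[OF y' i2 b] sq2 comp_assoc[OF y' m(2) i3] zy iz by simp
    then have "b \<cdot> (y \<oplus> Neg C (i\<^sub>2 \<cdot> y')) = Zero C Q P\<^sub>3"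
      using comp_diff[OF y iy b] plus_neg[OF by_mor] by simp
    from ker_b[OF plus_mor[OF y neg_mor[OF iy]] this] obtain x where
      x: "x \<in> Mor C Q P\<^sub>1" and yx: "y \<oplus> Neg C (i\<^sub>2 \<cdot> y') = a \<cdot> x" by blast
    obtain x' w where x': "x' \<in> Mor C Q X" and w: "w \<in> Mor C Q W"
      and split: "x = (i\<^sub>1 \<cdot> x') \<oplus> (j \<cdot> w)" by (rule hom_sum_split[OF sum x])
    note fx = comp_mor[OF x' m(1)] and jw = comp_mor[OF w j]
    note ifx = comp_mor[OF fx i2] and ajw = comp_mor[OF jw a]
    have "a \<cdot> x = (a \<cdot> (i\<^sub>1 \<cdot> x')) \<oplus> (a \<cdot> (j \<cdot> w))"
      unfolding split by (rule comp_plus_left[OF comp_mor[OF x' i1] jw a])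
    also have "a \<cdot> (i\<^sub>1 \<cdot> x') = i\<^sub>2 \<cdot> (f \<cdot> x')"
      using comp_assoc[OF x' i1 a] comp_assoc[OF x' m(1) i2] sq1 by simp
    finally have "y = ((i\<^sub>2 \<cdot> (f \<cdot> x')) \<oplus> (a \<cdot> (j \<cdot> w))) \<oplus> (i\<^sub>2 \<cdot> y')"
      using diff_plus_cancel[OF y iy] yx by simp
    also have "\<dots> = ((i\<^sub>2 \<cdot> (f \<cdot> x')) \<oplus> (i\<^sub>2 \<cdot> y')) \<oplus> (a \<cdot> (j \<cdot> w))"
      using plus_assoc[OF ifx ajw iy] plus_comm[OF ajw iy] plus_assoc[OF ifx iy ajw] by simp
    also have "(i\<^sub>2 \<cdot> (f \<cdot> x')) \<oplus> (i\<^sub>2 \<cdot> y') = i\<^sub>2 \<cdot> ((f \<cdot> x') \<oplus> y')"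
      by (rule comp_plus_left[OF fx y' i2, symmetric])
    also have "a \<cdot> (j \<cdot> w) = (a \<cdot> j) \<cdot> w" by (rule comp_assoc[OF w j a, symmetric])
    finally show ?thesis using plus_mor[OF fx y'] w by blast
  qed
  moreover have "y = Zero C Q Y \<and> w = Zero C Q W"
    if y: "y \<in> Mor C Q Y" and w: "w \<in> Mor C Q W"
      and eq: "(i\<^sub>2 \<cdot> y) \<oplus> ((a \<cdot> j) \<cdot> w) = Zero C Q P\<^sub>2" for Q y w
  proof -
    note Q = mor_dom[OF y] and iy = comp_mor[OF y i2] and ajw = comp_mor[OF w aj]
      and gy = comp_mor[OF y m(2)] and jw = comp_mor[OF w j]
    have "b \<cdot> ((i\<^sub>2 \<cdot> y) \<oplus> ((a \<cdot> j) \<cdot> w)) = Zero C Q P\<^sub>3" unfolding eq by (rule comp_zero_right[OF b Q])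
    moreover have "b \<cdot> ((a \<cdot> j) \<cdot> w) = Zero C Q P\<^sub>3"
      using comp_assoc[OF w j a] comp_assoc[OF jw a b] ba comp_zero_left[OF jw P3] by simp
    moreover have "b \<cdot> (i\<^sub>2 \<cdot> y) = i\<^sub>3 \<cdot> (g \<cdot> y)"
      using comp_assoc[OF y i2 b] comp_assoc[OF y m(2) i3] sq2 by simp
    ultimately have "i\<^sub>3 \<cdot> (g \<cdot> y) = Zero C Q P\<^sub>3"
      using comp_plus_left[OF iy ajw b] plus_zero[OF comp_mor[OF gy i3]] by simp
    then have "g \<cdot> y = Zero C Q Z"
      using comp_assoc[OF gy i3 k] ki comp_ident_left[OF gy] comp_zero_right[OF k Q] by simp
    then obtain x where x: "x \<in> Mor C Q X" and yx: "y = f \<cdot> x" by (rule exact_weak_kernel[OF ex y])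
    note ix = comp_mor[OF x i1]
    \<comment> \<open>The element \<open>v\<close> of \<open>P\<^sub>1\<close> is annihilated by \<open>a\<close>, so it comes from \<open>P\<^sub>3\<close>. As \<open>i\<^sub>3\<close> is invertible, it
      comes from \<open>X\<close> through \<open>h\<close>: it is \<open>i\<^sub>1 \<cdot> s\<close> with \<open>f \<cdot> s = 0\<close>. Uniqueness in \<open>P\<^sub>1\<close> forces \<open>x = s\<close>.\<close>
    let ?v = "(i\<^sub>1 \<cdot> x) \<oplus> (j \<cdot> w)"
    have v: "?v \<in> Mor C Q P\<^sub>1" by (rule plus_mor[OF ix jw])
    have "a \<cdot> ?v = (a \<cdot> (i\<^sub>1 \<cdot> x)) \<oplus> (a \<cdot> (j \<cdot> w))" by (rule comp_plus_left[OF ix jw a])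
    also have "a \<cdot> (i\<^sub>1 \<cdot> x) = i\<^sub>2 \<cdot> y"
      using comp_assoc[OF x i1 a] comp_assoc[OF x m(1) i2] sq1 yx by simp
    also have "a \<cdot> (j \<cdot> w) = (a \<cdot> j) \<cdot> w" by (rule comp_assoc[OF w j a, symmetric])
    finally have "a \<cdot> ?v = Zero C Q P\<^sub>2" using eq by simp
    from ker_a[OF v this] obtain t where t: "t \<in> Mor C (\<Sigma>\<^sub>o Q) P\<^sub>3" and vt: "\<Sigma>\<^sub>m ?v = c \<cdot> t" by blast
    note kt = comp_mor[OF t k]
    note hkt = comp_mor[OF kt m(3)]
    obtain s where s: "s \<in> Mor C Q X" and hs: "h \<cdot> (k \<cdot> t) = \<Sigma>\<^sub>m s" by (rule shift_full[OF Q X hkt])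
    note is_mor = comp_mor[OF s i1]
    have "c \<cdot> t = c \<cdot> (i\<^sub>3 \<cdot> (k \<cdot> t))" using comp_assoc[OF t k i3] ik comp_ident_left[OF t] by simp
    also have "\<dots> = \<Sigma>\<^sub>m i\<^sub>1 \<cdot> (h \<cdot> (k \<cdot> t))"
      using comp_assoc[OF kt i3 c] sq3 comp_assoc[OF kt m(3) shift.amap_mor[OF i1]] by simp
    also have "\<dots> = \<Sigma>\<^sub>m (i\<^sub>1 \<cdot> s)" unfolding hs by (rule shift.amap_comp[OF s i1, symmetric])
    finally have "\<Sigma>\<^sub>m ?v = \<Sigma>\<^sub>m (i\<^sub>1 \<cdot> s)" unfolding vt .
    then have vs: "?v = i\<^sub>1 \<cdot> s" by (rule shift_inject[OF v is_mor])
    have "(i\<^sub>1 \<cdot> (x \<oplus> Neg C s)) \<oplus> (j \<cdot> w) = ((i\<^sub>1 \<cdot> x) \<oplus> Neg C (i\<^sub>1 \<cdot> s)) \<oplus> (j \<cdot> w)"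
      using comp_diff[OF x s i1] by simp
    also have "\<dots> = ?v \<oplus> Neg C (i\<^sub>1 \<cdot> s)"
      using plus_assoc[OF ix neg_mor[OF is_mor] jw] plus_comm[OF neg_mor[OF is_mor] jw]
        plus_assoc[OF ix jw neg_mor[OF is_mor]] by simp
    also have "\<dots> = Zero C Q P\<^sub>1" unfolding vs by (rule plus_neg[OF is_mor])
    finally have xs0: "x \<oplus> Neg C s = Zero C Q X" and w0: "w = Zero C Q W"
      using hom_sum_unique[OF sum plus_mor[OF x neg_mor[OF s]] w] by simp_all
    have xs: "x = s" by (rule eq_if_diff_zero[OF x s xs0])
    have "\<Sigma>\<^sub>m y = \<Sigma>\<^sub>m f \<cdot> (h \<cdot> (k \<cdot> t))" unfolding yx xs hs by (rule shift.amap_comp[OF s m(1)])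
    also have "\<dots> = \<Sigma>\<^sub>m (Zero C Q Y)"
      using comp_assoc[OF kt m(3) shift.amap_mor[OF m(1)]] exact_comp_zero_shift[OF ex]
        comp_zero_left[OF kt shift.omap_obj[OF Y]] shift.amap_zero[OF Q Y] by simp
    finally have "y = Zero C Q Y" by (rule shift_inject[OF y zero_mor[OF Q Y]])
    then show ?thesis using w0 by blast
  qed
  ultimately have "is_hom_sum C Y W P\<^sub>2 i\<^sub>2 (a \<cdot> j)" using i2 aj unfolding is_hom_sum_def by blast
  then have "is_coproduct C Y W P\<^sub>2 i\<^sub>2 (a \<cdot> j)" by (rule is_coproduct_if_hom_sum)
  moreover have "triangle_mor C (Triangle W W N (Ident C W) (Zero C W N) (Zero C N (\<Sigma>\<^sub>o W)))
      (Triangle P\<^sub>1 P\<^sub>2 P\<^sub>3 a b c) j (a \<cdot> j) (Zero C N P\<^sub>3)"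
  proof -
    have N': "N \<in> Obj C" using N by (simp add: is_zero_object_def)
    note zW = zero_mor[OF W N'] and zP = zero_mor[OF N' P3]
      and zS = zero_mor[OF N' shift.omap_obj[OF W]]
    have "Zero C N P\<^sub>3 \<cdot> Zero C W N = b \<cdot> (a \<cdot> j)"
      using comp_zero_right[OF zP W] comp_assoc[OF j a b] ba comp_zero_left[OF j P3] by simp
    moreover have "\<Sigma>\<^sub>m j \<cdot> Zero C N (\<Sigma>\<^sub>o W) = c \<cdot> Zero C N P\<^sub>3"
      using comp_zero_right[OF shift.amap_mor[OF j] N'] comp_zero_right[OF c N'] by simp
    ultimately show ?thesis
      using ident_mor[OF W] zW zP zS a b c j aj comp_ident_right[OF aj] by simp
  qed
  moreover have "is_coproduct C Z N P\<^sub>3 i\<^sub>3 (Zero C N P\<^sub>3)"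
    by (rule is_coproduct_iso_zero_object[OF iso N])
  moreover have "is_coproduct C X W P\<^sub>1 i\<^sub>1 j" by (rule is_coproduct_if_hom_sum[OF sum])
  ultimately have "is_triangle_coproduct C (Triangle X Y Z f g h)
    (Triangle W W N (Ident C W) (Zero C W N) (Zero C N (\<Sigma>\<^sub>o W)))
    (Triangle P\<^sub>1 P\<^sub>2 P\<^sub>3 a b c) (i\<^sub>1, i\<^sub>2, i\<^sub>3) (j, a \<cdot> j, Zero C N P\<^sub>3)"
    using mor unfolding is_triangle_coproduct.simps by blast
  then show ?thesis using W by blast
qed

end

section \<open>Transposition along an adjunction\<close>

context adjunction
begin

definition right_transpose :: "'o1 \<Rightarrow> 'm2 \<Rightarrow> 'm1" where
  "right_transpose A b = amap G b \<cdot>\<^bsub>D\<^esub> \<eta> A"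

definition left_transpose :: "'o2 \<Rightarrow> 'm1 \<Rightarrow> 'm2" where
  "left_transpose B k = \<epsilon> B \<cdot>\<^bsub>E\<^esub> amap F k"

lemma unit_mor: "A \<in> Obj D \<Longrightarrow> \<eta> A \<in> Mor D A (omap G (omap F A))"
  using unit by (simp add: nat_trans_def id_functor_def comp_functor_def)

lemma unit_nat: "a \<in> Mor D A A' \<Longrightarrow> \<eta> A' \<cdot>\<^bsub>D\<^esub> a = amap G (amap F a) \<cdot>\<^bsub>D\<^esub> \<eta> A"
  using unit by (simp add: nat_trans_def id_functor_def comp_functor_def)

lemma counit_mor: "B \<in> Obj E \<Longrightarrow> \<epsilon> B \<in> Mor E (omap F (omap G B)) B"
  using counit by (simp add: nat_trans_def id_functor_def comp_functor_def)

lemma counit_nat: "b \<in> Mor E B B' \<Longrightarrow> \<epsilon> B' \<cdot>\<^bsub>E\<^esub> amap F (amap G b) = b \<cdot>\<^bsub>E\<^esub> \<epsilon> B"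
  using counit by (simp add: nat_trans_def id_functor_def comp_functor_def)

lemma right_transpose_mor:
  "A \<in> Obj D \<Longrightarrow> b \<in> Mor E (omap F A) B \<Longrightarrow> right_transpose A b \<in> Mor D A (omap G B)"
  unfolding right_transpose_def by (rule F.D.comp_mor[OF unit_mor G.amap_mor])

lemma left_transpose_mor:
  "B \<in> Obj E \<Longrightarrow> k \<in> Mor D A (omap G B) \<Longrightarrow> left_transpose B k \<in> Mor E (omap F A) B"
  unfolding left_transpose_def by (rule F.E.comp_mor[OF F.amap_mor counit_mor])

lemma right_transpose_comp_left:
  assumes A: "A \<in> Obj D" and b: "b \<in> Mor E (omap F A) B" and c: "c \<in> Mor E B B'"
  shows "right_transpose A (c \<cdot>\<^bsub>E\<^esub> b) = amap G c \<cdot>\<^bsub>D\<^esub> right_transpose A b"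
  unfolding right_transpose_def
  using G.amap_comp[OF b c] F.D.comp_assoc[OF unit_mor[OF A] G.amap_mor[OF b] G.amap_mor[OF c]]
  by simp

lemma right_transpose_comp_right:
  assumes a: "a \<in> Mor D A' A" and b: "b \<in> Mor E (omap F A) B"
  shows "right_transpose A' (b \<cdot>\<^bsub>E\<^esub> amap F a) = right_transpose A b \<cdot>\<^bsub>D\<^esub> a"
proof -
  note fa = F.amap_mor[OF a]
  have A: "A \<in> Obj D" "A' \<in> Obj D" using F.D.mor_cod[OF a] F.D.mor_dom[OF a] .
  have "right_transpose A' (b \<cdot>\<^bsub>E\<^esub> amap F a) = amap G b \<cdot>\<^bsub>D\<^esub> (amap G (amap F a) \<cdot>\<^bsub>D\<^esub> \<eta> A')"
    unfolding right_transpose_def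
    using G.amap_comp[OF fa b]
      F.D.comp_assoc[OF unit_mor[OF A(2)] G.amap_mor[OF fa] G.amap_mor[OF b]] by simp
  then show ?thesis
    unfolding right_transpose_def
    using unit_nat[OF a] F.D.comp_assoc[OF a unit_mor[OF A(1)] G.amap_mor[OF b]] by simp
qed

lemma left_transpose_comp_left:
  assumes k: "k \<in> Mor D A (omap G B)" and c: "c \<in> Mor E B B'"
  shows "left_transpose B' (amap G c \<cdot>\<^bsub>D\<^esub> k) = c \<cdot>\<^bsub>E\<^esub> left_transpose B k"
proof -
  note B = F.E.mor_dom[OF c] F.E.mor_cod[OF c] and gc = G.amap_mor[OF c]
  have "left_transpose B' (amap G c \<cdot>\<^bsub>D\<^esub> k) = (\<epsilon> B' \<cdot>\<^bsub>E\<^esub> amap F (amap G c)) \<cdot>\<^bsub>E\<^esub> amap F k"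
    unfolding left_transpose_def
    using F.amap_comp[OF k gc]
      F.E.comp_assoc[OF F.amap_mor[OF k] F.amap_mor[OF gc] counit_mor[OF B(2)]] by simp
  then show ?thesis
    unfolding left_transpose_def
    using counit_nat[OF c] F.E.comp_assoc[OF F.amap_mor[OF k] counit_mor[OF B(1)] c] by simp
qed

lemma left_transpose_right_transpose:
  assumes A: "A \<in> Obj D" and b: "b \<in> Mor E (omap F A) B"
  shows "left_transpose B (right_transpose A b) = b"
  using left_transpose_comp_left[OF unit_mor[OF A] b] triangle_left[OF A] F.E.comp_ident_right[OF b]
  unfolding right_transpose_def left_transpose_def by simp

lemma right_transpose_left_transpose:
  assumes B: "B \<in> Obj E" and k: "k \<in> Mor D A (omap G B)"
  shows "right_transpose A (left_transpose B k) = k"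
  using right_transpose_comp_right[OF k counit_mor[OF B]] triangle_right[OF B]
    F.D.comp_ident_left[OF k]
  unfolding right_transpose_def left_transpose_def by simp

text \<open>The inverse is the preimage of the counit at \<open>F A\<close>; both equations are triangle identities.\<close>

lemma unit_iso_if_fully_faithful:
  assumes ff: "fully_faithful D E F" and A: "A \<in> Obj D"
  shows "is_isomorphism D A (omap G (omap F A)) (\<eta> A)"
proof -
  note FA = F.omap_obj[OF A]
  note GFA = G.omap_obj[OF FA] and u = unit_mor[OF A]
  obtain h where h: "h \<in> Mor D (omap G (omap F A)) A" and fh: "amap F h = \<epsilon> (omap F A)"
    using ff counit_mor[OF FA] A GFA unfolding fully_faithful_def bij_betw_def by (metis imageE)
  have hu: "h \<cdot>\<^bsub>D\<^esub> \<eta> A \<in> Mor D A A" by (rule F.D.comp_mor[OF u h])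
  have id: "Ident D A \<in> Mor D A A" by (rule F.D.ident_mor[OF A])
  have "amap F (h \<cdot>\<^bsub>D\<^esub> \<eta> A) = amap F (Ident D A)"
    using F.amap_comp[OF u h] fh triangle_left[OF A] F.amap_ident[OF A] by simp
  then have "h \<cdot>\<^bsub>D\<^esub> \<eta> A = Ident D A"
    using ff A hu id unfolding fully_faithful_def bij_betw_def inj_on_def by blast
  moreover have "\<eta> A \<cdot>\<^bsub>D\<^esub> h = Ident D (omap G (omap F A))"
    using unit_nat[OF h] fh triangle_right[OF FA] by simp
  ultimately show ?thesis
    unfolding is_isomorphism_def inverse_arrows_def using u h by blast
qed

end

section \<open>The right adjoint of an exact functor\<close>

locale exact_adjunction = exact_functor D E F \<phi> + adj: adjunction D E F G \<eta> \<epsilon>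
  for D :: "('o1, 'm1, 'b) triang_cat_scheme" and E :: "('o2, 'm2, 'c) triang_cat_scheme"
    and F :: "('o1, 'm1, 'o2, 'm2) functr" and \<phi> :: "'o1 \<Rightarrow> 'm2"
    and G :: "('o2, 'm2, 'o1, 'm1) functr" and \<eta> :: "'o1 \<Rightarrow> 'm1" and \<epsilon> :: "'o2 \<Rightarrow> 'm2"
begin

abbreviation comparison :: "'o2 \<Rightarrow> 'm1" where
  "comparison \<equiv> radj_comparison D E \<phi> G \<eta> \<epsilon>"

abbreviation shift_comm :: "'o2 \<Rightarrow> 'm1" where
  "shift_comm \<equiv> radj_shift_iso D E \<phi> G \<eta> \<epsilon>"

lemma phi_mor: "A \<in> Obj D \<Longrightarrow>
    \<phi> A \<in> Mor E (omap F (\<Sigma>\<^sub>o\<^bsub>D\<^esub> A)) (\<Sigma>\<^sub>o\<^bsub>E\<^esub> (omap F A))"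
  using shift_iso by (simp add: nat_iso_def nat_trans_def comp_functor_def)

lemma phi_nat: "a \<in> Mor D A B \<Longrightarrow>
    \<phi> B \<cdot>\<^bsub>E\<^esub> amap F (\<Sigma>\<^sub>m\<^bsub>D\<^esub> a) = \<Sigma>\<^sub>m\<^bsub>E\<^esub> (amap F a) \<cdot>\<^bsub>E\<^esub> \<phi> A"
  using shift_iso by (simp add: nat_iso_def nat_trans_def comp_functor_def)

lemma shift_comm_inverse:
  assumes "X \<in> Obj E"
  shows "inverse_arrows D (\<Sigma>\<^sub>o\<^bsub>D\<^esub> (omap G X)) (omap G (\<Sigma>\<^sub>o\<^bsub>E\<^esub> X)) (comparison X) (shift_comm X)"
  unfolding radj_shift_iso_def
  by (rule D.inv_arrow_works[OF radj_comparison_iso[OF exact_functor_axioms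
        adj.adjunction_axioms assms]])

text \<open>The comparison is itself a transpose, so naturality of transposition and of \<open>\<phi>\<close> moves the shift
  from \<open>D\<close> to \<open>E\<close>. All squares that involve the third map of a triangle are verified through this.\<close>

lemma comparison_shift:
  assumes A: "A \<in> Obj D" and b: "b \<in> Mor E (omap F A) X"
  shows "comparison X \<cdot>\<^bsub>D\<^esub> \<Sigma>\<^sub>m\<^bsub>D\<^esub> (adj.right_transpose A b)
    = adj.right_transpose (\<Sigma>\<^sub>o\<^bsub>D\<^esub> A) (\<Sigma>\<^sub>m\<^bsub>E\<^esub> b \<cdot>\<^bsub>E\<^esub> \<phi> A)"
proof -
  let ?a = "adj.right_transpose A b"
  note X = E.mor_cod[OF b] and a = adj.right_transpose_mor[OF A b]
  note GX = adj.G.omap_obj[OF X] and eps = adj.counit_mor[OF X]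
  note se = E.shift.amap_mor[OF eps] and sfa = E.shift.amap_mor[OF amap_mor[OF a]]
  have "comparison X \<cdot>\<^bsub>D\<^esub> \<Sigma>\<^sub>m\<^bsub>D\<^esub> ?a
      = adj.right_transpose (\<Sigma>\<^sub>o\<^bsub>D\<^esub> (omap G X)) (\<Sigma>\<^sub>m\<^bsub>E\<^esub> (\<epsilon> X) \<cdot>\<^bsub>E\<^esub> \<phi> (omap G X)) \<cdot>\<^bsub>D\<^esub> \<Sigma>\<^sub>m\<^bsub>D\<^esub> ?a"
    by (simp add: radj_comparison_def adj.right_transpose_def)
  also have "\<dots> = adj.right_transpose (\<Sigma>\<^sub>o\<^bsub>D\<^esub> A)
      ((\<Sigma>\<^sub>m\<^bsub>E\<^esub> (\<epsilon> X) \<cdot>\<^bsub>E\<^esub> \<phi> (omap G X)) \<cdot>\<^bsub>E\<^esub> amap F (\<Sigma>\<^sub>m\<^bsub>D\<^esub> ?a))"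
    by (rule adj.right_transpose_comp_right[OF D.shift.amap_mor[OF a]
          E.comp_mor[OF phi_mor[OF GX] se], symmetric])
  also have "(\<Sigma>\<^sub>m\<^bsub>E\<^esub> (\<epsilon> X) \<cdot>\<^bsub>E\<^esub> \<phi> (omap G X)) \<cdot>\<^bsub>E\<^esub> amap F (\<Sigma>\<^sub>m\<^bsub>D\<^esub> ?a)
      = \<Sigma>\<^sub>m\<^bsub>E\<^esub> (\<epsilon> X) \<cdot>\<^bsub>E\<^esub> (\<Sigma>\<^sub>m\<^bsub>E\<^esub> (amap F ?a) \<cdot>\<^bsub>E\<^esub> \<phi> A)"
    using E.comp_assoc[OF amap_mor[OF D.shift.amap_mor[OF a]] phi_mor[OF GX] se] phi_nat[OF a]
    by simp
  also have "\<dots> = \<Sigma>\<^sub>m\<^bsub>E\<^esub> (adj.left_transpose X ?a) \<cdot>\<^bsub>E\<^esub> \<phi> A"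
    unfolding adj.left_transpose_def
    using E.comp_assoc[OF phi_mor[OF A] sfa se] E.shift.amap_comp[OF amap_mor[OF a] eps] by simp
  finally show ?thesis unfolding adj.left_transpose_right_transpose[OF A b] .
qed

lemma left_transpose_zero:
  assumes A: "A \<in> Obj D" and B: "B \<in> Obj E"
  shows "adj.left_transpose B (Zero D A (omap G B)) = Zero E (omap F A) B"
  unfolding adj.left_transpose_def
  using amap_zero[OF A adj.G.omap_obj[OF B]]
    E.comp_zero_right[OF adj.counit_mor[OF B] omap_obj[OF A]] by simp

lemma right_transpose_zero:
  assumes A: "A \<in> Obj D" and B: "B \<in> Obj E"
  shows "adj.right_transpose A (Zero E (omap F A) B) = Zero D A (omap G B)"
  using adj.right_transpose_left_transpose[OF B D.zero_mor[OF A adj.G.omap_obj[OF B]]]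
  unfolding left_transpose_zero[OF A B] .

text \<open>A map \<open>k\<close> into \<open>G B\<close> is zero if its transpose is, so \<open>G\<close> inherits this from \<open>F\<close>.\<close>

lemma right_adjoint_zero:
  assumes A: "A \<in> Obj E" and B: "B \<in> Obj E"
  shows "amap G (Zero E A B) = Zero D (omap G A) (omap G B)"
proof -
  note GA = adj.G.omap_obj[OF A] and z = E.zero_mor[OF A B]
  note id = D.ident_mor[OF GA] and gz = adj.G.amap_mor[OF z]
  have "adj.left_transpose B (amap G (Zero E A B)) = Zero E (omap F (omap G A)) B"
    using adj.left_transpose_comp_left[OF id z] D.comp_ident_right[OF gz]
      E.comp_zero_left[OF adj.left_transpose_mor[OF A id] B] by simp
  then show ?thesis
    using adj.right_transpose_left_transpose[OF B gz] right_transpose_zero[OF GA B] by simp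
qed

text \<open>\<open>Hom(Q, G -)\<close> is \<open>Hom(F Q, -)\<close>, so exactness at \<open>G Y\<close> is exactness at \<open>Y\<close>. Exactness at
  \<open>(G X)[1]\<close> follows in the same way once \<open>F (Q[1])\<close> is replaced by \<open>(F Q)[1]\<close> using \<open>\<phi>\<close>.\<close>

lemma hom_exact_right_adjoint:
  assumes ex: "Triangle X Y Z f g h \<in> Exact E"
  shows "hom_exact D (functor_triangle D G shift_comm (Triangle X Y Z f g h))"
proof -
  note m = E.exact_mors[OF ex]
  note X = E.mor_dom[OF m(1)] and Y = E.mor_dom[OF m(2)] and Z = E.mor_dom[OF m(3)]
  note gf = adj.G.amap_mor[OF m(1)] and gg = adj.G.amap_mor[OF m(2)]
    and gh = adj.G.amap_mor[OF m(3)]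
  have p: "shift_comm X \<in> Mor D (omap G (\<Sigma>\<^sub>o\<^bsub>E\<^esub> X)) (\<Sigma>\<^sub>o\<^bsub>D\<^esub> (omap G X))"
    and pc: "shift_comm X \<cdot>\<^bsub>D\<^esub> comparison X = Ident D (\<Sigma>\<^sub>o\<^bsub>D\<^esub> (omap G X))"
    and comp: "comparison X \<in> Mor D (\<Sigma>\<^sub>o\<^bsub>D\<^esub> (omap G X)) (omap G (\<Sigma>\<^sub>o\<^bsub>E\<^esub> X))"
    using shift_comm_inverse[OF X] by (auto simp: inverse_arrows_def)
  have "amap G g \<cdot>\<^bsub>D\<^esub> amap G f = Zero D (omap G X) (omap G Z)"
    using adj.G.amap_comp[OF m(1,2)] E.exact_comp_zero[OF ex] right_adjoint_zero[OF X Z] by simp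
  moreover have "(shift_comm X \<cdot>\<^bsub>D\<^esub> amap G h) \<cdot>\<^bsub>D\<^esub> amap G g
      = Zero D (omap G Y) (\<Sigma>\<^sub>o\<^bsub>D\<^esub> (omap G X))"
    using D.comp_assoc[OF gg gh p] adj.G.amap_comp[OF m(2,3)]
      E.exact_comp_zero[OF E.exact_rotate[OF ex]]
      right_adjoint_zero[OF Y E.mor_cod[OF m(3)]] D.comp_zero_right[OF p adj.G.omap_obj[OF Y]]
    by simp
  moreover have "\<exists>x \<in> Mor D Q (omap G X). y = amap G f \<cdot>\<^bsub>D\<^esub> x"
    if y: "y \<in> Mor D Q (omap G Y)" and gy: "amap G g \<cdot>\<^bsub>D\<^esub> y = Zero D Q (omap G Z)" for Q y
  proof -
    note Q = D.mor_dom[OF y]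
    have "g \<cdot>\<^bsub>E\<^esub> adj.left_transpose Y y = Zero E (omap F Q) Z"
      using adj.left_transpose_comp_left[OF y m(2)] gy left_transpose_zero[OF Q Z] by simp
    then obtain x where x: "x \<in> Mor E (omap F Q) X" and yx: "adj.left_transpose Y y = f \<cdot>\<^bsub>E\<^esub> x"
      by (rule E.exact_weak_kernel[OF ex adj.left_transpose_mor[OF Y y]])
    have "y = amap G f \<cdot>\<^bsub>D\<^esub> adj.right_transpose Q x"
      using adj.right_transpose_left_transpose[OF Y y]
        adj.right_transpose_comp_left[OF Q x m(1)] yx by simp
    then show ?thesis using adj.right_transpose_mor[OF Q x] by blast
  qed
  moreover have "\<exists>t \<in> Mor D (\<Sigma>\<^sub>o\<^bsub>D\<^esub> Q) (omap G Z).
      \<Sigma>\<^sub>m\<^bsub>D\<^esub> x = (shift_comm X \<cdot>\<^bsub>D\<^esub> amap G h) \<cdot>\<^bsub>D\<^esub> t"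
    if x: "x \<in> Mor D Q (omap G X)" and fx: "amap G f \<cdot>\<^bsub>D\<^esub> x = Zero D Q (omap G Y)" for Q x
  proof -
    let ?b = "adj.left_transpose X x"
    note Q = D.mor_dom[OF x] and b = adj.left_transpose_mor[OF X x]
    note SQ = D.shift.omap_obj[OF Q] and sx = D.shift.amap_mor[OF x]
    have "f \<cdot>\<^bsub>E\<^esub> ?b = Zero E (omap F Q) Y"
      using adj.left_transpose_comp_left[OF x m(1)] fx left_transpose_zero[OF Q Y] by simp
    then have "\<Sigma>\<^sub>m\<^bsub>E\<^esub> f \<cdot>\<^bsub>E\<^esub> \<Sigma>\<^sub>m\<^bsub>E\<^esub> ?b = Zero E (\<Sigma>\<^sub>o\<^bsub>E\<^esub> (omap F Q)) (\<Sigma>\<^sub>o\<^bsub>E\<^esub> Y)"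
      using E.shift.amap_comp[OF b m(1)] E.shift.amap_zero[OF omap_obj[OF Q] Y] by simp
    then obtain t where t: "t \<in> Mor E (\<Sigma>\<^sub>o\<^bsub>E\<^esub> (omap F Q)) Z" and bt: "\<Sigma>\<^sub>m\<^bsub>E\<^esub> ?b = h \<cdot>\<^bsub>E\<^esub> t"
      by (rule E.exact_weak_kernel_shift[OF ex E.shift.amap_mor[OF b]])
    note tp = E.comp_mor[OF phi_mor[OF Q] t]
    let ?t = "adj.right_transpose (\<Sigma>\<^sub>o\<^bsub>D\<^esub> Q) (t \<cdot>\<^bsub>E\<^esub> \<phi> Q)"
    have t': "?t \<in> Mor D (\<Sigma>\<^sub>o\<^bsub>D\<^esub> Q) (omap G Z)" by (rule adj.right_transpose_mor[OF SQ tp])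
    have "amap G h \<cdot>\<^bsub>D\<^esub> ?t = adj.right_transpose (\<Sigma>\<^sub>o\<^bsub>D\<^esub> Q) (\<Sigma>\<^sub>m\<^bsub>E\<^esub> ?b \<cdot>\<^bsub>E\<^esub> \<phi> Q)"
      using adj.right_transpose_comp_left[OF SQ tp m(3)] E.comp_assoc[OF phi_mor[OF Q] t m(3)] bt
      by simp
    also have "\<dots> = comparison X \<cdot>\<^bsub>D\<^esub> \<Sigma>\<^sub>m\<^bsub>D\<^esub> x"
      using comparison_shift[OF Q b] adj.right_transpose_left_transpose[OF X x] by simp
    finally have "(shift_comm X \<cdot>\<^bsub>D\<^esub> amap G h) \<cdot>\<^bsub>D\<^esub> ?t = \<Sigma>\<^sub>m\<^bsub>D\<^esub> x"
      using D.comp_assoc[OF t' gh p] D.comp_assoc[OF sx comp p] pc D.comp_ident_left[OF sx] by simp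
    then show ?thesis using t' by metis
  qed
  ultimately show ?thesis using gf gg D.comp_mor[OF gh p] by simp
qed

text \<open>The first two squares are naturality of transposition. The third one is compared in
  \<open>G (X'[1])\<close>, to which \<open>(G X')[1]\<close> is isomorphic by the comparison map.\<close>

lemma right_transpose_triangle_mor:
  assumes exD: "Triangle X Y Z f g h \<in> Exact D"
    and mor: "triangle_mor E
      (Triangle (omap F X) (omap F Y) (omap F Z) (amap F f) (amap F g) (\<phi> X \<cdot>\<^bsub>E\<^esub> amap F h))
      (Triangle X' Y' Z' f' g' h') u v w"
  shows "triangle_mor D (Triangle X Y Z f g h)
    (functor_triangle D G shift_comm (Triangle X' Y' Z' f' g' h'))
    (adj.right_transpose X u) (adj.right_transpose Y v) (adj.right_transpose Z w)"
proof -
  note m = D.exact_mors[OF exD]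
  note X = D.mor_dom[OF m(1)] and Y = D.mor_dom[OF m(2)] and Z = D.mor_dom[OF m(3)]
  have f': "f' \<in> Mor E X' Y'" and g': "g' \<in> Mor E Y' Z'" and h': "h' \<in> Mor E Z' (\<Sigma>\<^sub>o\<^bsub>E\<^esub> X')"
    and u: "u \<in> Mor E (omap F X) X'" and v: "v \<in> Mor E (omap F Y) Y'"
    and w: "w \<in> Mor E (omap F Z) Z'"
    and sq1: "v \<cdot>\<^bsub>E\<^esub> amap F f = f' \<cdot>\<^bsub>E\<^esub> u" and sq2: "w \<cdot>\<^bsub>E\<^esub> amap F g = g' \<cdot>\<^bsub>E\<^esub> v"
    and sq3: "\<Sigma>\<^sub>m\<^bsub>E\<^esub> u \<cdot>\<^bsub>E\<^esub> (\<phi> X \<cdot>\<^bsub>E\<^esub> amap F h) = h' \<cdot>\<^bsub>E\<^esub> w"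
    using mor by auto
  note X' = E.mor_dom[OF f'] and u' = adj.right_transpose_mor[OF X u]
    and v' = adj.right_transpose_mor[OF Y v] and w' = adj.right_transpose_mor[OF Z w]
  note gh = adj.G.amap_mor[OF h'] and su = D.shift.amap_mor[OF u'] and eu = E.shift.amap_mor[OF u]
  have p: "shift_comm X' \<in> Mor D (omap G (\<Sigma>\<^sub>o\<^bsub>E\<^esub> X')) (\<Sigma>\<^sub>o\<^bsub>D\<^esub> (omap G X'))"
    and pc: "shift_comm X' \<cdot>\<^bsub>D\<^esub> comparison X' = Ident D (\<Sigma>\<^sub>o\<^bsub>D\<^esub> (omap G X'))"
    and comp: "comparison X' \<in> Mor D (\<Sigma>\<^sub>o\<^bsub>D\<^esub> (omap G X')) (omap G (\<Sigma>\<^sub>o\<^bsub>E\<^esub> X'))"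
    using shift_comm_inverse[OF X'] by (auto simp: inverse_arrows_def)
  have "adj.right_transpose Y v \<cdot>\<^bsub>D\<^esub> f = amap G f' \<cdot>\<^bsub>D\<^esub> adj.right_transpose X u"
    using adj.right_transpose_comp_right[OF m(1) v] sq1 adj.right_transpose_comp_left[OF X u f']
    by simp
  moreover have "adj.right_transpose Z w \<cdot>\<^bsub>D\<^esub> g = amap G g' \<cdot>\<^bsub>D\<^esub> adj.right_transpose Y v"
    using adj.right_transpose_comp_right[OF m(2) w] sq2 adj.right_transpose_comp_left[OF Y v g']
    by simp
  moreover have "\<Sigma>\<^sub>m\<^bsub>D\<^esub> (adj.right_transpose X u) \<cdot>\<^bsub>D\<^esub> h
      = (shift_comm X' \<cdot>\<^bsub>D\<^esub> amap G h') \<cdot>\<^bsub>D\<^esub> adj.right_transpose Z w"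
  proof -
    note suh = D.comp_mor[OF m(3) su]
    have "comparison X' \<cdot>\<^bsub>D\<^esub> (\<Sigma>\<^sub>m\<^bsub>D\<^esub> (adj.right_transpose X u) \<cdot>\<^bsub>D\<^esub> h)
        = adj.right_transpose (\<Sigma>\<^sub>o\<^bsub>D\<^esub> X) (\<Sigma>\<^sub>m\<^bsub>E\<^esub> u \<cdot>\<^bsub>E\<^esub> \<phi> X) \<cdot>\<^bsub>D\<^esub> h"
      using D.comp_assoc[OF m(3) su comp] comparison_shift[OF X u] by simp
    also have "\<dots> = adj.right_transpose Z ((\<Sigma>\<^sub>m\<^bsub>E\<^esub> u \<cdot>\<^bsub>E\<^esub> \<phi> X) \<cdot>\<^bsub>E\<^esub> amap F h)"
      by (rule adj.right_transpose_comp_right[OF m(3) E.comp_mor[OF phi_mor[OF X] eu], symmetric])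
    also have "(\<Sigma>\<^sub>m\<^bsub>E\<^esub> u \<cdot>\<^bsub>E\<^esub> \<phi> X) \<cdot>\<^bsub>E\<^esub> amap F h = h' \<cdot>\<^bsub>E\<^esub> w"
      using E.comp_assoc[OF amap_mor[OF m(3)] phi_mor[OF X] eu] sq3 by simp
    also have "adj.right_transpose Z (h' \<cdot>\<^bsub>E\<^esub> w) = amap G h' \<cdot>\<^bsub>D\<^esub> adj.right_transpose Z w"
      by (rule adj.right_transpose_comp_left[OF Z w h'])
    finally have eq: "comparison X' \<cdot>\<^bsub>D\<^esub> (\<Sigma>\<^sub>m\<^bsub>D\<^esub> (adj.right_transpose X u) \<cdot>\<^bsub>D\<^esub> h)
        = amap G h' \<cdot>\<^bsub>D\<^esub> adj.right_transpose Z w" .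
    have "\<Sigma>\<^sub>m\<^bsub>D\<^esub> (adj.right_transpose X u) \<cdot>\<^bsub>D\<^esub> h
        = shift_comm X' \<cdot>\<^bsub>D\<^esub> (comparison X' \<cdot>\<^bsub>D\<^esub> (\<Sigma>\<^sub>m\<^bsub>D\<^esub> (adj.right_transpose X u) \<cdot>\<^bsub>D\<^esub> h))"
      using D.comp_assoc[OF suh comp p] pc D.comp_ident_left[OF suh] by simp
    then show ?thesis unfolding eq using D.comp_assoc[OF w' gh p] by simp
  qed
  ultimately show ?thesis
    using m u' v' w' adj.G.amap_mor[OF f'] adj.G.amap_mor[OF g'] D.comp_mor[OF gh p] by simp
qed

end

section \<open>Auslander-Reiten triangles under a right adjoint\<close>

text \<open>A map \<open>u\<close> that is not a section factors through \<open>f\<close>, and \<open>f[1] \<cdot> h = 0\<close>.\<close>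

lemma (in triangulated_category) AR_first_section:
  assumes AR: "AR_triangle C (Triangle X Y Z f g h)" and u: "u \<in> Mor C X U"
    and nz: "\<Sigma>\<^sub>m u \<cdot> h \<noteq> Zero C Z (\<Sigma>\<^sub>o U)"
  shows "is_section C X U u"
proof (rule ccontr)
  assume "\<not> is_section C X U u"
  moreover have ex: "Triangle X Y Z f g h \<in> Exact C" and "left_almost_split C X Y f"
    using AR by auto
  ultimately obtain k where k: "k \<in> Mor C Y U" and uk: "u = k \<cdot> f"
    using u mor_cod[OF u] unfolding left_almost_split_def by blast
  note m = exact_mors[OF ex]
  note sk = shift.amap_mor[OF k]
  have "\<Sigma>\<^sub>m u \<cdot> h = \<Sigma>\<^sub>m k \<cdot> (\<Sigma>\<^sub>m f \<cdot> h)"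
    unfolding uk using shift.amap_comp[OF m(1) k]
      comp_assoc[OF m(3) shift.amap_mor[OF m(1)] sk] by simp
  also have "\<dots> = Zero C Z (\<Sigma>\<^sub>o U)"
    unfolding exact_comp_zero_shift[OF ex] by (rule comp_zero_right[OF sk mor_dom[OF m(3)]])
  finally show False using nz by simp
qed

lemma (in is_functor) retraction_if_image_retraction:
  assumes ff: "fully_faithful D E F" and f: "f \<in> Mor D A B"
    and ret: "is_retraction E (omap F A) (omap F B) (amap F f)"
  shows "is_retraction D A B f"
proof -
  note A = D.mor_dom[OF f] and B = D.mor_cod[OF f]
  obtain k where k: "k \<in> Mor E (omap F B) (omap F A)"
    and fk: "amap F f \<cdot>\<^bsub>E\<^esub> k = Ident E (omap F B)"
    using ret unfolding is_retraction_def by blast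
  obtain s where s: "s \<in> Mor D B A" and ks: "amap F s = k"
    using ff k A B unfolding fully_faithful_def bij_betw_def by (metis imageE)
  have "amap F (f \<cdot>\<^bsub>D\<^esub> s) = amap F (Ident D B)"
    using amap_comp[OF s f] ks fk amap_ident[OF B] by simp
  then have "f \<cdot>\<^bsub>D\<^esub> s = Ident D B"
    using ff B D.comp_mor[OF s f] D.ident_mor[OF B]
    unfolding fully_faithful_def bij_betw_def inj_on_def by blast
  then show ?thesis unfolding is_retraction_def using f s by blast
qed

theorem proposition8p1:
  fixes S :: "('o1, 'm1, 'b) triang_cat_scheme"
    and T :: "('o2, 'm2, 'c) triang_cat_scheme"
    and F :: "('o1, 'm1, 'o2, 'm2) functr" and \<phi> :: "'o1 \<Rightarrow> 'm2"
    and G :: "('o2, 'm2, 'o1, 'm1) functr"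
    and \<eta> :: "'o1 \<Rightarrow> 'm1" and \<epsilon> :: "'o2 \<Rightarrow> 'm2"
  assumes "triangulated_category S" and "triangulated_category T"
    and "exact_functor S T F \<phi>"
    and "fully_faithful S T F"
    and "adjunction S T F G \<eta> \<epsilon>"
    and "AR_triangle S (Triangle X\<^sub>S Y\<^sub>S Z\<^sub>S \<alpha>\<^sub>S \<beta>\<^sub>S \<gamma>\<^sub>S)"
    and "AR_triangle T (Triangle X\<^sub>T Y\<^sub>T Z\<^sub>T \<alpha>\<^sub>T \<beta>\<^sub>T \<gamma>\<^sub>T)"
    and "Z\<^sub>T = omap F Z\<^sub>S"
  shows "\<exists>W \<in> Obj S. \<exists>O\<^sub>S. is_zero_object S O\<^sub>S \<and>
    (\<exists>i\<^sub>X i\<^sub>Y j\<^sub>X j\<^sub>Y j\<^sub>Z. is_triangle_coproduct S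
      (Triangle X\<^sub>S Y\<^sub>S Z\<^sub>S \<alpha>\<^sub>S \<beta>\<^sub>S \<gamma>\<^sub>S)
      (Triangle W W O\<^sub>S (Ident S W) (Zero S W O\<^sub>S) (Zero S O\<^sub>S (\<Sigma>\<^sub>o\<^bsub>S\<^esub> W)))
      (functor_triangle S G (radj_shift_iso S T \<phi> G \<eta> \<epsilon>) (Triangle X\<^sub>T Y\<^sub>T Z\<^sub>T \<alpha>\<^sub>T \<beta>\<^sub>T \<gamma>\<^sub>T))
      (i\<^sub>X, i\<^sub>Y, \<eta> Z\<^sub>S) (j\<^sub>X, j\<^sub>Y, j\<^sub>Z))"
proof -
  interpret exact_adjunction S T F \<phi> G \<eta> \<epsilon>
    using assms(3,5) by (simp add: exact_adjunction_def)
  note ff = assms(4)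
  have exS: "Triangle X\<^sub>S Y\<^sub>S Z\<^sub>S \<alpha>\<^sub>S \<beta>\<^sub>S \<gamma>\<^sub>S \<in> Exact S"
    and rasS: "right_almost_split S Y\<^sub>S Z\<^sub>S \<beta>\<^sub>S" using assms(6) by auto
  have exT: "Triangle X\<^sub>T Y\<^sub>T (omap F Z\<^sub>S) \<alpha>\<^sub>T \<beta>\<^sub>T \<gamma>\<^sub>T \<in> Exact T"
    and rasT: "right_almost_split T Y\<^sub>T (omap F Z\<^sub>S) \<beta>\<^sub>T" using assms(7,8) by auto
  note m = D.exact_mors[OF exS] and m' = E.exact_mors[OF exT]
  note Z = D.mor_dom[OF m(3)] and X' = E.mor_dom[OF m'(1)] and Fb = amap_mor[OF m(2)]
  note FZ = omap_obj[OF Z]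
  note id = E.ident_mor[OF FZ]
  have "\<not> is_retraction T (omap F Y\<^sub>S) (omap F Z\<^sub>S) (amap F \<beta>\<^sub>S)"
    using retraction_if_image_retraction[OF ff m(2)] rasS unfolding right_almost_split_def by blast
  then obtain v where v: "v \<in> Mor T (omap F Y\<^sub>S) Y\<^sub>T" and bv: "amap F \<beta>\<^sub>S = \<beta>\<^sub>T \<cdot>\<^bsub>T\<^esub> v"
    using rasT Fb E.mor_dom[OF Fb] unfolding right_almost_split_def by blast
  have "Ident T (omap F Z\<^sub>S) \<cdot>\<^bsub>T\<^esub> amap F \<beta>\<^sub>S = \<beta>\<^sub>T \<cdot>\<^bsub>T\<^esub> v"
    using E.comp_ident_left[OF Fb] bv by simp
  then obtain u where morT: "triangle_mor T
      (Triangle (omap F X\<^sub>S) (omap F Y\<^sub>S) (omap F Z\<^sub>S) (amap F \<alpha>\<^sub>S) (amap F \<beta>\<^sub>S) (\<phi> X\<^sub>S \<cdot>\<^bsub>T\<^esub> amap F \<gamma>\<^sub>S))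
      (Triangle X\<^sub>T Y\<^sub>T (omap F Z\<^sub>S) \<alpha>\<^sub>T \<beta>\<^sub>T \<gamma>\<^sub>T) u v (Ident T (omap F Z\<^sub>S))"
    by (rule E.exact_mor_completion_first[OF preserves_exact[OF exS] exT v id])
  let ?i = "adj.right_transpose X\<^sub>S u" and ?c = "shift_comm X\<^sub>T \<cdot>\<^bsub>S\<^esub> amap G \<gamma>\<^sub>T"
  have "adj.right_transpose Z\<^sub>S (Ident T (omap F Z\<^sub>S)) = \<eta> Z\<^sub>S"
    unfolding adj.right_transpose_def
    using adj.G.amap_ident[OF FZ] D.comp_ident_left[OF adj.unit_mor[OF Z]] by simp
  then have mor: "triangle_mor S (Triangle X\<^sub>S Y\<^sub>S Z\<^sub>S \<alpha>\<^sub>S \<beta>\<^sub>S \<gamma>\<^sub>S)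
      (functor_triangle S G shift_comm (Triangle X\<^sub>T Y\<^sub>T (omap F Z\<^sub>S) \<alpha>\<^sub>T \<beta>\<^sub>T \<gamma>\<^sub>T))
      ?i (adj.right_transpose Y\<^sub>S v) (\<eta> Z\<^sub>S)"
    using right_transpose_triangle_mor[OF exS morT] by simp
  have i: "?i \<in> Mor S X\<^sub>S (omap G X\<^sub>T)" and sq3: "\<Sigma>\<^sub>m\<^bsub>S\<^esub> ?i \<cdot>\<^bsub>S\<^esub> \<gamma>\<^sub>S = ?c \<cdot>\<^bsub>S\<^esub> \<eta> Z\<^sub>S"
    using mor by auto
  have "\<Sigma>\<^sub>m\<^bsub>S\<^esub> ?i \<cdot>\<^bsub>S\<^esub> \<gamma>\<^sub>S \<noteq> Zero S Z\<^sub>S (\<Sigma>\<^sub>o\<^bsub>S\<^esub> (omap G X\<^sub>T))"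
  proof
    \<comment> \<open>By the third square, \<open>i[1] \<cdot> \<gamma>\<^sub>S\<close> is the transpose of \<open>\<gamma>\<^sub>T\<close> followed by the isomorphism \<open>p\<close>.\<close>
    assume 0: "\<Sigma>\<^sub>m\<^bsub>S\<^esub> ?i \<cdot>\<^bsub>S\<^esub> \<gamma>\<^sub>S = Zero S Z\<^sub>S (\<Sigma>\<^sub>o\<^bsub>S\<^esub> (omap G X\<^sub>T))"
    let ?p = "shift_comm X\<^sub>T" and ?q = "comparison X\<^sub>T" and ?g = "adj.right_transpose Z\<^sub>S \<gamma>\<^sub>T"
    have p: "?p \<in> Mor S (omap G (\<Sigma>\<^sub>o\<^bsub>T\<^esub> X\<^sub>T)) (\<Sigma>\<^sub>o\<^bsub>S\<^esub> (omap G X\<^sub>T))"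
      and q: "?q \<in> Mor S (\<Sigma>\<^sub>o\<^bsub>S\<^esub> (omap G X\<^sub>T)) (omap G (\<Sigma>\<^sub>o\<^bsub>T\<^esub> X\<^sub>T))"
      and qp: "?q \<cdot>\<^bsub>S\<^esub> ?p = Ident S (omap G (\<Sigma>\<^sub>o\<^bsub>T\<^esub> X\<^sub>T))"
      using shift_comm_inverse[OF X'] by (auto simp: inverse_arrows_def)
    note g = adj.right_transpose_mor[OF Z m'(3)]
    have "?p \<cdot>\<^bsub>S\<^esub> ?g = Zero S Z\<^sub>S (\<Sigma>\<^sub>o\<^bsub>S\<^esub> (omap G X\<^sub>T))"
      using 0 sq3 D.comp_assoc[OF adj.unit_mor[OF Z] adj.G.amap_mor[OF m'(3)] p]
      unfolding adj.right_transpose_def by simp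
    then have "?g = Zero S Z\<^sub>S (omap G (\<Sigma>\<^sub>o\<^bsub>T\<^esub> X\<^sub>T))"
      using D.comp_assoc[OF g p q] qp D.comp_ident_left[OF g] D.comp_zero_right[OF q Z] by simp
    then have "\<gamma>\<^sub>T = Zero T (omap F Z\<^sub>S) (\<Sigma>\<^sub>o\<^bsub>T\<^esub> X\<^sub>T)"
      using adj.left_transpose_right_transpose[OF Z m'(3)]
        left_transpose_zero[OF Z E.mor_cod[OF m'(3)]] by simp
    then show False
      using E.retraction_if_third_zero[OF exT] rasT unfolding right_almost_split_def by blast
  qed
  then have sec: "is_section S X\<^sub>S (omap G X\<^sub>T) ?i" by (rule D.AR_first_section[OF assms(6) i])
  obtain N where N: "is_zero_object S N" using D.ex_zero_object by blast
  show ?thesis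
    using D.triangle_summand_if_section[OF exS
        hom_exact_right_adjoint[OF exT, unfolded functor_triangle.simps]
        mor[unfolded functor_triangle.simps] sec adj.unit_iso_if_fully_faithful[OF ff Z] N] N
    unfolding assms(8) functor_triangle.simps by blast
qed

end
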